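(* Let $q_0\in\mathcal{Q}$, $q_0\neq0$, be fixed, and let $H_{\alpha T}(\lambda)=J_\alpha(\lambda q_0)$ for $\lambda\in\mathbb{R}$, where $J_\alpha(q)=\frac12\|u_{\alpha q}-z_d\|_{\mathcal{H}}^2+\frac M2\|q\|_{\mathcal{Q}}^2$. For each $\alpha>0$ and each $T>0$ there exists a unique $\overline{\lambda}_\alpha(T)\in\mathbb{R}$ such that $$H_{\alpha T}(\overline{\lambda}_\alpha(T))=\min_{\lambda\in\mathbb{R}}H_{\alpha T}(\lambda).$$
   Context: $\Omega\subset\mathbb{R}^n$ is a bounded domain with regular boundary $\Gamma=\Gamma_1\cup\Gamma_2$, $\Gamma_1,\Gamma_2$ disjoint with positive $(n-1)$-dimensional measure. For $T>0$ put $V=H^1(\Omega)$, $H=L^2(\Omega)$, $Q=L^2(\Gamma_2)$, $\mathcal{H}=L^2(0,T;H)$, $\mathcal{Q}=L^2(0,T;Q)$, and for $\alpha>0$ let $a_\alpha(u,v)=\int_\Omega\nabla u\cdot\nabla v\,dx+\alpha\int_{\Gamma_1}uv\,d\gamma$. Fixed data: $g\in\mathcal{H}$, $z_d\in\mathcal{H}$, $b\in H^{1/2}(\Gamma_1)$, $v_b\in V$ with $v_b=b$ on $\Gamma_1$, and a constant $M>0$; data and domain are sufficiently smooth for the variational problem below to have a unique solution. For $q\in\mathcal{Q}$, $u_{\alpha q}$ is the unique function with $u_{\alpha q}\in L^2(0,T;V)$, $\dot u_{\alpha q}\in L^2(0,T;V')$, $u_{\alpha q}(0)=v_b$ and, for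 a.e. $t\in(0,T)$, $\langle\dot u_{\alpha q}(t),v\rangle+a_\alpha(u_{\alpha q}(t),v)=(g(t),v)_H-(q(t),v)_Q+\alpha\int_{\Gamma_1}bv\,d\gamma$ for all $v\in V$ (traces are understood on $\Gamma_1,\Gamma_2$). *)

theory Defs
  imports "HOL-Analysis.Analysis"
begin

text \<open>
  Elements of all function spaces below are represented by real-valued functions, and
  identification up to null sets is made explicit wherever it matters. Functions
  on \<open>\<Omega>\<close> or on a part of its boundary are total functions whose values elsewhere are irrelevant.
\<close>

section \<open>Surface measure\<close>

text \<open>
  The \<open>s\<close>-dimensional Hausdorff measure, normalised so as to agree with Lebesgue measure when
  \<open>s\<close> is the dimension. The surface measure is the case \<open>s = n - 1\<close>. Empty sets are treated
  separately because \<open>0 ^ 0 = 1\<close>, and the boundedness condition is there because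
  \<^const>\<open>diameter\<close> is meaningless on unbounded sets.
\<close>

definition hausdorff_weight :: "nat \<Rightarrow> 'a::euclidean_space set \<Rightarrow> ennreal" where
  "hausdorff_weight s C =
     (if C = {} then 0 else ennreal (unit_ball_vol (real s) / 2 ^ s * diameter C ^ s))"

definition hausdorff_content :: "nat \<Rightarrow> real \<Rightarrow> 'a::euclidean_space set \<Rightarrow> ennreal" where
  "hausdorff_content s \<delta> A =
     (INF C\<in>{C :: nat \<Rightarrow> 'a set. A \<subseteq> (\<Union>i. C i) \<and> (\<forall>i. bounded (C i) \<and> diameter (C i) \<le> \<delta>)}.
        \<Sum>i. hausdorff_weight s (C i))"

definition hausdorff_outer :: "nat \<Rightarrow> 'a::euclidean_space set \<Rightarrow> ennreal" where
  "hausdorff_outer s A = (SUP \<delta>\<in>{0<..}. hausdorff_content s \<delta> A)"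

definition hausdorff_measure :: "nat \<Rightarrow> 'a::euclidean_space measure" where
  "hausdorff_measure s =
     measure_of UNIV (lambda_system UNIV (Pow UNIV) (hausdorff_outer s)) (hausdorff_outer s)"

abbreviation surface_measure :: "'a::euclidean_space measure" where
  "surface_measure \<equiv> hausdorff_measure (DIM('a) - 1)"

abbreviation surface_on :: "'a::euclidean_space set \<Rightarrow> 'a measure" where
  "surface_on \<Gamma> \<equiv> restrict_space surface_measure \<Gamma>"

lemma hausdorff_content_empty: "0 < \<delta> \<Longrightarrow> hausdorff_content s \<delta> {} = 0"
  unfolding hausdorff_content_def
  by (rule antisym, rule INF_lower2[where i = "\<lambda>_. {}"]) (auto simp: hausdorff_weight_def)

lemma hausdorff_content_mono: "A \<subseteq> B \<Longrightarrow> hausdorff_content s \<delta> A \<le> hausdorff_content s \<delta> B"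
  unfolding hausdorff_content_def by (rule INF_superset_mono) auto

lemma hausdorff_content_subadditive:
  fixes A :: "nat \<Rightarrow> 'a::euclidean_space set"
  shows "hausdorff_content s \<delta> (\<Union>i. A i) \<le> (\<Sum>i. hausdorff_content s \<delta> (A i))"
proof (rule ennreal_le_epsilon)
  fix e :: real
  assume e: "0 < e" and fin: "(\<Sum>n. hausdorff_content s \<delta> (A n)) < top"
  have *: "hausdorff_content s \<delta> (A n) < hausdorff_content s \<delta> (A n) + e * (1/2)^Suc n" for n
    using e fin by (auto simp add: less_top dest!: ennreal_suminf_lessD)
  have "\<exists>B. A n \<subseteq> (\<Union>i. B i) \<and> (\<forall>i. bounded (B i) \<and> diameter (B i) \<le> \<delta>) \<and>
      (\<Sum>i. hausdorff_weight s (B i)) \<le> hausdorff_content s \<delta> (A n) + e * (1/2)^Suc n" for n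
    using *[of n] unfolding hausdorff_content_def INF_less_iff by (blast intro: less_imp_le)
  then obtain B where sub: "\<And>n. A n \<subseteq> (\<Union>i. B n i)"
    and small: "\<And>n i. bounded (B n i) \<and> diameter (B n i) \<le> \<delta>"
    and le: "\<And>n. (\<Sum>i. hausdorff_weight s (B n i))
                \<le> hausdorff_content s \<delta> (A n) + e * (1/2)^Suc n"
    by metis
  define C where "C = case_prod B o prod_decode"
  have "(\<Union>i. A i) \<subseteq> (\<Union>i. C i)"
    using sub by (auto simp add: C_def subset_eq) (metis prod.case prod_encode_inverse)
  moreover have "bounded (C i) \<and> diameter (C i) \<le> \<delta>" for i
    using small by (auto simp: C_def split_def)
  ultimately have "hausdorff_content s \<delta> (\<Union>i. A i) \<le> (\<Sum>i. hausdorff_weight s (C i))"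
    unfolding hausdorff_content_def by (intro INF_lower) auto
  also have "\<dots> = (\<Sum>n. \<Sum>i. hausdorff_weight s (B n i))"
    unfolding C_def comp_def
    using suminf_ennreal_2dimen[of "\<lambda>n. \<Sum>i. hausdorff_weight s (B n i)"
        "\<lambda>p. hausdorff_weight s (case_prod B p)"] by simp
  also have "\<dots> \<le> (\<Sum>n. hausdorff_content s \<delta> (A n) + e * (1/2)^Suc n)"
    by (intro suminf_le le) auto
  also have "\<dots> = (\<Sum>n. hausdorff_content s \<delta> (A n)) + (\<Sum>n. ennreal e * ennreal ((1/2)^Suc n))"
    using e by (subst suminf_add[symmetric])
      (auto simp del: ennreal_suminf_cmult simp add: ennreal_mult[symmetric])
  also have "\<dots> = (\<Sum>n. hausdorff_content s \<delta> (A n)) + e"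
    unfolding ennreal_suminf_cmult
    by (subst suminf_ennreal_eq[OF zero_le_power power_half_series]) auto
  finally show "hausdorff_content s \<delta> (\<Union>i. A i) \<le> (\<Sum>n. hausdorff_content s \<delta> (A n)) + e" .
qed

lemma outer_measure_space_hausdorff: "outer_measure_space UNIV (hausdorff_outer s)"
proof -
  have "hausdorff_outer s (\<Union>i. A i) \<le> (\<Sum>i. hausdorff_outer s (A i))"
    for A :: "nat \<Rightarrow> 'a set"
    unfolding hausdorff_outer_def[of s "\<Union>i. A i"]
  proof (rule SUP_least)
    fix \<delta> :: real assume "\<delta> \<in> {0<..}"
    then have "(\<Sum>i. hausdorff_content s \<delta> (A i)) \<le> (\<Sum>i. hausdorff_outer s (A i))"
      unfolding hausdorff_outer_def by (intro suminf_le SUP_upper) auto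
    with hausdorff_content_subadditive[of s \<delta> A]
    show "hausdorff_content s \<delta> (\<Union>i. A i) \<le> (\<Sum>i. hausdorff_outer s (A i))"
      by (rule order_trans)
  qed
  moreover have "hausdorff_outer s A \<le> hausdorff_outer s B" if "A \<subseteq> B" for A B :: "'a set"
    unfolding hausdorff_outer_def using that by (intro SUP_mono) (auto intro: hausdorff_content_mono)
  moreover have "hausdorff_outer s ({} :: 'a set) = 0"
    unfolding hausdorff_outer_def
    by (rule antisym, rule SUP_least) (simp_all add: hausdorff_content_empty)
  ultimately show ?thesis
    by (auto simp: outer_measure_space_def positive_def increasing_def countably_subadditive_def)
qed

lemma
  fixes s :: nat
  shows space_hausdorff_measure: "space (hausdorff_measure s) = (UNIV :: 'a::euclidean_space set)"
    and sets_hausdorff_measure: "sets (hausdorff_measure s :: 'a measure) =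
          lambda_system UNIV (Pow UNIV) (hausdorff_outer s)"
    and emeasure_hausdorff_measure: "A \<in> sets (hausdorff_measure s :: 'a measure) \<Longrightarrow>
          emeasure (hausdorff_measure s) A = hausdorff_outer s A"
proof -
  let ?L = "lambda_system UNIV (Pow UNIV) (hausdorff_outer s) :: 'a set set"
  have ms: "measure_space UNIV ?L (hausdorff_outer s)"
    using sigma_algebra.caratheodory_lemma[OF sigma_algebra_Pow, of "UNIV :: 'a set" "hausdorff_outer s"]
      outer_measure_space_hausdorff[of s] by simp
  then have sig: "sigma_algebra UNIV ?L"
    by (simp add: measure_space_def)
  show "space (hausdorff_measure s) = (UNIV :: 'a set)"
    by (simp add: hausdorff_measure_def space_measure_of_conv)
  show sets: "sets (hausdorff_measure s :: 'a measure) = ?L"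
    using sigma_algebra.sigma_sets_eq[OF sig] by (simp add: hausdorff_measure_def sets_measure_of_conv)
  show "emeasure (hausdorff_measure s) A = hausdorff_outer s A"
    if "A \<in> sets (hausdorff_measure s :: 'a measure)"
    unfolding hausdorff_measure_def
    using ms that sets by (intro emeasure_measure_of_sigma) (auto simp: measure_space_def)
qed

section \<open>Domains with Lipschitz boundary\<close>

text \<open>
  Near each boundary point, and in the direction of a suitable unit vector \<open>e\<close>, the set is the
  strict epigraph of a Lipschitz function of the component orthogonal to \<open>e\<close>.
\<close>

definition lipschitz_boundary :: "'a::euclidean_space set \<Rightarrow> bool" where
  "lipschitz_boundary \<Omega> \<longleftrightarrow>
     (\<forall>x\<in>frontier \<Omega>. \<exists>r>0. \<exists>e. norm e = 1 \<and> (\<exists>L. \<exists>h :: 'a \<Rightarrow> real. L-lipschitz_on UNIV h \<and>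
        \<Omega> \<inter> ball x r = {y \<in> ball x r. h (y - (y \<bullet> e) *\<^sub>R e) < y \<bullet> e}))"

section \<open>Test functions\<close>

primrec Ck :: "nat \<Rightarrow> ('a::euclidean_space \<Rightarrow> real) \<Rightarrow> bool" where
  "Ck 0 f \<longleftrightarrow> continuous_on UNIV f"
| "Ck (Suc k) f \<longleftrightarrow> (\<exists>F :: 'a \<Rightarrow> 'a. (\<forall>x. (f has_derivative (\<lambda>h. F x \<bullet> h)) (at x)) \<and>
                      (\<forall>i\<in>Basis. Ck k (\<lambda>x. F x \<bullet> i)))"

definition test_function :: "'a::euclidean_space set \<Rightarrow> ('a \<Rightarrow> real) \<Rightarrow> bool" where
  "test_function U \<phi> \<longleftrightarrow> (\<forall>k. Ck k \<phi>) \<and>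
     compact (closure {x. \<phi> x \<noteq> 0}) \<and> closure {x. \<phi> x \<noteq> 0} \<subseteq> U"

section \<open>Lebesgue and Sobolev spaces\<close>

definition L2 :: "'a measure \<Rightarrow> ('a \<Rightarrow> real) set" where
  "L2 \<mu> = {f \<in> borel_measurable \<mu>. integrable \<mu> (\<lambda>x. (f x)\<^sup>2)}"

definition L2_norm :: "'a measure \<Rightarrow> ('a \<Rightarrow> real) \<Rightarrow> real" where
  "L2_norm \<mu> f = sqrt (LINT x|\<mu>. (f x)\<^sup>2)"

definition L2_inner :: "'a measure \<Rightarrow> ('a \<Rightarrow> real) \<Rightarrow> ('a \<Rightarrow> real) \<Rightarrow> real" where
  "L2_inner \<mu> f h = (LINT x|\<mu>. f x * h x)"

definition weak_gradient ::
    "'a::euclidean_space set \<Rightarrow> ('a \<Rightarrow> real) \<Rightarrow> ('a \<Rightarrow> 'a) \<Rightarrow> bool" where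
  "weak_gradient \<Omega> f G \<longleftrightarrow>
     (\<forall>i\<in>Basis. (\<lambda>x. G x \<bullet> i) \<in> L2 (lebesgue_on \<Omega>)) \<and>
     (\<forall>\<phi>. test_function \<Omega> \<phi> \<longrightarrow> (\<forall>i\<in>Basis.
        (LINT x|lebesgue_on \<Omega>. f x * frechet_derivative \<phi> (at x) i) =
        - (LINT x|lebesgue_on \<Omega>. (G x \<bullet> i) * \<phi> x)))"

definition H1 :: "'a::euclidean_space set \<Rightarrow> ('a \<Rightarrow> real) set" where
  "H1 \<Omega> = {f \<in> L2 (lebesgue_on \<Omega>). \<exists>G. weak_gradient \<Omega> f G}"

text \<open>The weak gradient is unique up to null sets only, so this selects a representative.\<close>

definition grad :: "'a::euclidean_space set \<Rightarrow> ('a \<Rightarrow> real) \<Rightarrow> 'a \<Rightarrow> 'a" where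
  "grad \<Omega> f = (SOME G. weak_gradient \<Omega> f G)"

definition H1_norm :: "'a::euclidean_space set \<Rightarrow> ('a \<Rightarrow> real) \<Rightarrow> real" where
  "H1_norm \<Omega> f = sqrt ((L2_norm (lebesgue_on \<Omega>) f)\<^sup>2 + (LINT x|lebesgue_on \<Omega>. (norm (grad \<Omega> f x))\<^sup>2))"

text \<open>
  \<open>H\<^sup>1(\<Omega>)'\<close>: functionals are only looked at on \<^const>\<open>H1\<close>. Boundedness makes them insensitive
  to the choice of representatives.
\<close>

definition H1_dual :: "'a::euclidean_space set \<Rightarrow> (('a \<Rightarrow> real) \<Rightarrow> real) set" where
  "H1_dual \<Omega> = {F.
     (\<forall>u\<in>H1 \<Omega>. \<forall>v\<in>H1 \<Omega>. \<forall>c d. F (\<lambda>x. c * u x + d * v x) = c * F u + d * F v) \<and>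
     (\<exists>C. \<forall>v\<in>H1 \<Omega>. \<bar>F v\<bar> \<le> C * H1_norm \<Omega> v)}"

definition H1_dual_norm :: "'a::euclidean_space set \<Rightarrow> (('a \<Rightarrow> real) \<Rightarrow> real) \<Rightarrow> real" where
  "H1_dual_norm \<Omega> F = (SUP v\<in>{v \<in> H1 \<Omega>. H1_norm \<Omega> v \<le> 1}. \<bar>F v\<bar>)"

text \<open>
  The trace operator is characterised as in the trace theorem: a bounded linear map from
  \<open>H\<^sup>1(\<Omega>)\<close> to \<open>L\<^sup>2(\<partial>\<Omega>)\<close> that restricts functions continuous up to the boundary. On a bounded
  Lipschitz domain it exists and is unique up to null sets.
\<close>

definition trace_operator ::
    "'a::euclidean_space set \<Rightarrow> (('a \<Rightarrow> real) \<Rightarrow> 'a \<Rightarrow> real) \<Rightarrow> bool" where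
  "trace_operator \<Omega> tr \<longleftrightarrow>
     (\<forall>v\<in>H1 \<Omega>. tr v \<in> L2 (surface_on (frontier \<Omega>))) \<and>
     (\<forall>u\<in>H1 \<Omega>. \<forall>v\<in>H1 \<Omega>. \<forall>c d. AE x in surface_on (frontier \<Omega>).
        tr (\<lambda>y. c * u y + d * v y) x = c * tr u x + d * tr v x) \<and>
     (\<exists>C. \<forall>v\<in>H1 \<Omega>. L2_norm (surface_on (frontier \<Omega>)) (tr v) \<le> C * H1_norm \<Omega> v) \<and>
     (\<forall>v\<in>H1 \<Omega>. continuous_on (closure \<Omega>) v \<longrightarrow> (AE x in surface_on (frontier \<Omega>). tr v x = v x))"

text \<open>
  \<open>H\<^sup>1\<^sup>/\<^sup>2(\<Gamma>)\<close> via the Sobolev-Slobodeckij seminorm; the exponent is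
  \<open>dim \<Gamma> + 2 \<cdot> 1/2 = (n - 1) + 1 = n\<close>.
\<close>

definition H_half :: "'a::euclidean_space set \<Rightarrow> ('a \<Rightarrow> real) set" where
  "H_half \<Gamma> = {b \<in> L2 (surface_on \<Gamma>).
     (\<integral>\<^sup>+x. \<integral>\<^sup>+y. ennreal ((b x - b y)\<^sup>2 / dist x y ^ DIM('a)) \<partial>surface_on \<Gamma> \<partial>surface_on \<Gamma>) < \<infinity>}"

section \<open>Bochner spaces\<close>

text \<open>
  \<open>L\<^sup>2(0,T;X)\<close> for a space \<open>X\<close> (of representatives) with norm \<open>N\<close>: strong measurability, that is,
  almost everywhere approximation in \<open>N\<close> by simple \<open>X\<close>-valued functions, together
  with square integrability of the norm.
\<close>

definition strongly_measurable ::
    "real \<Rightarrow> ('s \<Rightarrow> real) set \<Rightarrow> (('s \<Rightarrow> real) \<Rightarrow> real) \<Rightarrow> (real \<Rightarrow> 's \<Rightarrow> real) \<Rightarrow> bool" where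
  "strongly_measurable T X N u \<longleftrightarrow>
     (\<exists>s :: nat \<Rightarrow> real \<Rightarrow> 's \<Rightarrow> real.
        (\<forall>k. simple_function (lebesgue_on {0<..<T}) (s k) \<and> (\<forall>t\<in>{0<..<T}. s k t \<in> X)) \<and>
        (AE t in lebesgue_on {0<..<T}. (\<lambda>k. N (\<lambda>x. s k t x - u t x)) \<longlonglongrightarrow> 0))"

definition L2_time ::
    "real \<Rightarrow> ('s \<Rightarrow> real) set \<Rightarrow> (('s \<Rightarrow> real) \<Rightarrow> real) \<Rightarrow> (real \<Rightarrow> 's \<Rightarrow> real) set" where
  "L2_time T X N = {u. (AE t in lebesgue_on {0<..<T}. u t \<in> X) \<and> strongly_measurable T X N u \<and>
     integrable (lebesgue_on {0<..<T}) (\<lambda>t. (N (u t))\<^sup>2)}"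

definition L2_time_norm ::
    "real \<Rightarrow> (('s \<Rightarrow> real) \<Rightarrow> real) \<Rightarrow> (real \<Rightarrow> 's \<Rightarrow> real) \<Rightarrow> real" where
  "L2_time_norm T N u = sqrt (LINT t|lebesgue_on {0<..<T}. (N (u t))\<^sup>2)"

abbreviation L2L2 :: "real \<Rightarrow> 'a measure \<Rightarrow> (real \<Rightarrow> 'a \<Rightarrow> real) set" where
  "L2L2 T \<mu> \<equiv> L2_time T (L2 \<mu>) (L2_norm \<mu>)"

abbreviation L2L2_norm :: "real \<Rightarrow> 'a measure \<Rightarrow> (real \<Rightarrow> 'a \<Rightarrow> real) \<Rightarrow> real" where
  "L2L2_norm T \<mu> \<equiv> L2_time_norm T (L2_norm \<mu>)"

definition eq_time :: "real \<Rightarrow> 'a measure \<Rightarrow> (real \<Rightarrow> 'a \<Rightarrow> real) \<Rightarrow> (real \<Rightarrow> 'a \<Rightarrow> real) \<Rightarrow> bool" where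
  "eq_time T \<mu> u w \<longleftrightarrow> (AE t in lebesgue_on {0<..<T}. AE x in \<mu>. u t x = w t x)"

section \<open>The parabolic problem and the cost functional\<close>

text \<open>
  \<open>w\<close> is the distributional time derivative of \<open>u\<close> with values in \<open>H\<^sup>1(\<Omega>)'\<close>, where \<open>L\<^sup>2(\<Omega>)\<close> is
  embedded in \<open>H\<^sup>1(\<Omega>)'\<close> by the inner product. The defining identity in \<open>H\<^sup>1(\<Omega>)'\<close> is
  evaluated at each \<open>v\<close>.
\<close>

definition weak_time_derivative :: "'a::euclidean_space set \<Rightarrow> real \<Rightarrow>
    (real \<Rightarrow> 'a \<Rightarrow> real) \<Rightarrow> (real \<Rightarrow> ('a \<Rightarrow> real) \<Rightarrow> real) \<Rightarrow> bool" where
  "weak_time_derivative \<Omega> T u w \<longleftrightarrow>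
     (\<forall>v\<in>H1 \<Omega>. \<forall>\<phi>. test_function {0<..<T} \<phi> \<longrightarrow>
        (LINT t|lebesgue_on {0<..<T}. L2_inner (lebesgue_on \<Omega>) (u t) v * deriv \<phi> t) =
        - (LINT t|lebesgue_on {0<..<T}. w t v * \<phi> t))"

text \<open>
  The initial condition refers to the representative of \<open>u\<close> in \<open>C([0,T];L\<^sup>2(\<Omega>))\<close>.
\<close>

definition initial_value ::
    "'a::euclidean_space set \<Rightarrow> real \<Rightarrow> (real \<Rightarrow> 'a \<Rightarrow> real) \<Rightarrow> ('a \<Rightarrow> real) \<Rightarrow> bool" where
  "initial_value \<Omega> T u u0 \<longleftrightarrow>
     (\<exists>U. eq_time T (lebesgue_on \<Omega>) U u \<and>
        (\<forall>t\<in>{0..T}. U t \<in> L2 (lebesgue_on \<Omega>)) \<and>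
        (\<forall>s\<in>{0..T}. ((\<lambda>t. L2_norm (lebesgue_on \<Omega>) (\<lambda>x. U t x - U s x)) \<longlongrightarrow> 0) (at s within {0..T})) \<and>
        (AE x in lebesgue_on \<Omega>. U 0 x = u0 x))"

definition form_a :: "'a::euclidean_space set \<Rightarrow> 'a set \<Rightarrow> (('a \<Rightarrow> real) \<Rightarrow> 'a \<Rightarrow> real) \<Rightarrow> real \<Rightarrow>
    ('a \<Rightarrow> real) \<Rightarrow> ('a \<Rightarrow> real) \<Rightarrow> real" where
  "form_a \<Omega> \<Gamma>1 tr \<alpha> u v =
     (LINT x|lebesgue_on \<Omega>. grad \<Omega> u x \<bullet> grad \<Omega> v x) +
     \<alpha> * (LINT x|surface_on \<Gamma>1. tr u x * tr v x)"

definition is_state :: "'a::euclidean_space set \<Rightarrow> 'a set \<Rightarrow> 'a set \<Rightarrow>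
    (('a \<Rightarrow> real) \<Rightarrow> 'a \<Rightarrow> real) \<Rightarrow> real \<Rightarrow> (real \<Rightarrow> 'a \<Rightarrow> real) \<Rightarrow> ('a \<Rightarrow> real) \<Rightarrow> ('a \<Rightarrow> real) \<Rightarrow>
    real \<Rightarrow> (real \<Rightarrow> 'a \<Rightarrow> real) \<Rightarrow> (real \<Rightarrow> 'a \<Rightarrow> real) \<Rightarrow> bool" where
  "is_state \<Omega> \<Gamma>1 \<Gamma>2 tr T g b vb \<alpha> q u \<longleftrightarrow>
     u \<in> L2_time T (H1 \<Omega>) (H1_norm \<Omega>) \<and>
     initial_value \<Omega> T u vb \<and>
     (\<exists>w \<in> L2_time T (H1_dual \<Omega>) (H1_dual_norm \<Omega>).
        weak_time_derivative \<Omega> T u w \<and>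
        (AE t in lebesgue_on {0<..<T}. \<forall>v\<in>H1 \<Omega>.
           w t v + form_a \<Omega> \<Gamma>1 tr \<alpha> (u t) v =
             L2_inner (lebesgue_on \<Omega>) (g t) v
             - L2_inner (surface_on \<Gamma>2) (q t) (tr v)
             + \<alpha> * (LINT x|surface_on \<Gamma>1. b x * tr v x)))"

definition state :: "'a::euclidean_space set \<Rightarrow> 'a set \<Rightarrow> 'a set \<Rightarrow>
    (('a \<Rightarrow> real) \<Rightarrow> 'a \<Rightarrow> real) \<Rightarrow> real \<Rightarrow> (real \<Rightarrow> 'a \<Rightarrow> real) \<Rightarrow> ('a \<Rightarrow> real) \<Rightarrow> ('a \<Rightarrow> real) \<Rightarrow>
    real \<Rightarrow> (real \<Rightarrow> 'a \<Rightarrow> real) \<Rightarrow> real \<Rightarrow> 'a \<Rightarrow> real" where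
  "state \<Omega> \<Gamma>1 \<Gamma>2 tr T g b vb \<alpha> q = (SOME u. is_state \<Omega> \<Gamma>1 \<Gamma>2 tr T g b vb \<alpha> q u)"

definition uniquely_solvable :: "'a::euclidean_space set \<Rightarrow> 'a set \<Rightarrow> 'a set \<Rightarrow>
    (('a \<Rightarrow> real) \<Rightarrow> 'a \<Rightarrow> real) \<Rightarrow> real \<Rightarrow> (real \<Rightarrow> 'a \<Rightarrow> real) \<Rightarrow> ('a \<Rightarrow> real) \<Rightarrow> ('a \<Rightarrow> real) \<Rightarrow>
    real \<Rightarrow> (real \<Rightarrow> 'a \<Rightarrow> real) \<Rightarrow> bool" where
  "uniquely_solvable \<Omega> \<Gamma>1 \<Gamma>2 tr T g b vb \<alpha> q \<longleftrightarrow>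
     (\<exists>u. is_state \<Omega> \<Gamma>1 \<Gamma>2 tr T g b vb \<alpha> q u \<and>
        (\<forall>u'. is_state \<Omega> \<Gamma>1 \<Gamma>2 tr T g b vb \<alpha> q u' \<longrightarrow> eq_time T (lebesgue_on \<Omega>) u' u))"

definition cost_J :: "'a::euclidean_space set \<Rightarrow> 'a set \<Rightarrow> 'a set \<Rightarrow>
    (('a \<Rightarrow> real) \<Rightarrow> 'a \<Rightarrow> real) \<Rightarrow> real \<Rightarrow> (real \<Rightarrow> 'a \<Rightarrow> real) \<Rightarrow> ('a \<Rightarrow> real) \<Rightarrow> ('a \<Rightarrow> real) \<Rightarrow>
    (real \<Rightarrow> 'a \<Rightarrow> real) \<Rightarrow> real \<Rightarrow> real \<Rightarrow> (real \<Rightarrow> 'a \<Rightarrow> real) \<Rightarrow> real" where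
  "cost_J \<Omega> \<Gamma>1 \<Gamma>2 tr T g b vb zd M \<alpha> q =
     1 / 2 * (L2L2_norm T (lebesgue_on \<Omega>)
        (\<lambda>t x. state \<Omega> \<Gamma>1 \<Gamma>2 tr T g b vb \<alpha> q t x - zd t x))\<^sup>2
     + M / 2 * (L2L2_norm T (surface_on \<Gamma>2) q)\<^sup>2"

end

theory Submission
  imports Defs
begin

text \<open>
  The problem is linear and \<open>q \<mapsto> u\<^sub>\<alpha>\<^sub>q\<close> is affine, so by unique solvability the state of
  \<open>\<lambda> q\<^sub>0\<close> is \<open>(1 - \<lambda>) u\<^sub>0 + \<lambda> u\<^sub>1\<close> up to null sets, where \<open>u\<^sub>0\<close> and \<open>u\<^sub>1\<close> are the states of
  \<open>0\<close> and \<open>q\<^sub>0\<close>. Hence \<open>H\<close> is a quadratic polynomial in \<open>\<lambda>\<close> with leading coefficient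
  at least \<open>M/2 \<parallel>q\<^sub>0\<parallel>\<^sup>2 > 0\<close>. The work lies in the linearity: \<^const>\<open>grad\<close> is linear only
  because weak gradients are unique up to null sets, that is, by the fundamental lemma of the calculus
  of variations, and splitting the time integrals requires measurability of \<open>t \<mapsto> \<Phi> (u t)\<close> for
  functionals \<open>\<Phi>\<close> that are Lipschitz in the norm in which \<open>u\<close> is strongly measurable.
\<close>

section \<open>The fundamental lemma of the calculus of variations\<close>

text \<open>All spaces consist of representatives, all norms are seminorms, and \<open>state\<close>
  selects its value by Hilbert choice. Two descriptions of the same state therefore agree only in
  the sense of \<open>eq_time\<close>; the cost tolerates this because its norms depend on classes
  alone. The data \<open>g\<close>, \<open>b\<close> and \<open>vb\<close> stay fixed while the
  control varies, which is why states are combined with weights of sum 1. The integral of a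
  non-integrable function is 0 by convention, so no integral may be split before integrability is
  known. For a time-dependent vector this starts from strong measurability: a Lipschitz functional
  turns the approximating vector-valued simple functions into real ones, and since Lebesgue measure
  is complete, their almost everywhere limit is measurable. The cross term of the quadratic
  polynomial pairs two time-dependent vectors and is not of this kind; polarisation expresses it
  through squared norms, each of which is.\<close>

lemma Ck_imp_continuous_on: "Ck k f \<Longrightarrow> continuous_on UNIV f"
proof (cases k)
  case (Suc n)
  moreover assume "Ck k f"
  ultimately obtain F where "\<And>x. (f has_derivative (\<lambda>h. F x \<bullet> h)) (at x)" by auto
  then show ?thesis
    by (meson continuous_at_imp_continuous_on has_derivative_continuous)
qed simp

text \<open>Needed for the product rule: the derivative of a product contains the factors
  themselves, which must then count as members of the class one order lower.\<close>

lemma Ck_SucD: "Ck (Suc k) f \<Longrightarrow> Ck k f"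
proof (induction k arbitrary: f)
  case 0
  show ?case using Ck_imp_continuous_on[OF "0.prems"] by simp
next
  case (Suc k)
  from Suc.prems obtain F where "\<forall>x. (f has_derivative (\<lambda>h. F x \<bullet> h)) (at x)"
    "\<forall>i\<in>Basis. Ck (Suc k) (\<lambda>x. F x \<bullet> i)" by auto
  with Suc.IH show ?case by (auto simp del: Ck.simps(2) simp: Ck.simps(2)[of k f])
qed

lemma Ck_const: "Ck k (\<lambda>x. c)"
proof (induction k arbitrary: c)
  case (Suc k)
  then show ?case by (auto intro!: exI[of _ "\<lambda>x. 0"])
qed simp

lemma Ck_add: "Ck k f \<Longrightarrow> Ck k g \<Longrightarrow> Ck k (\<lambda>x. f x + g x)"
proof (induction k arbitrary: f g)
  case 0
  then show ?case by (simp add: continuous_on_add)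
next
  case (Suc k)
  from Suc.prems obtain F G where
    "\<forall>x. (f has_derivative (\<lambda>h. F x \<bullet> h)) (at x)" "\<forall>i\<in>Basis. Ck k (\<lambda>x. F x \<bullet> i)"
    "\<forall>x. (g has_derivative (\<lambda>h. G x \<bullet> h)) (at x)" "\<forall>i\<in>Basis. Ck k (\<lambda>x. G x \<bullet> i)"
    by auto
  then show ?case
    by (auto intro!: exI[of _ "\<lambda>x. F x + G x"] derivative_eq_intros Suc.IH simp: inner_add_left)
qed

lemma Ck_mult: "Ck k f \<Longrightarrow> Ck k g \<Longrightarrow> Ck k (\<lambda>x. f x * g x)"
proof (induction k arbitrary: f g)
  case 0
  then show ?case by (simp add: continuous_on_mult)
next
  case (Suc k)
  from Suc.prems obtain F G where FG:
    "\<forall>x. (f has_derivative (\<lambda>h. F x \<bullet> h)) (at x)" "\<forall>i\<in>Basis. Ck k (\<lambda>x. F x \<bullet> i)"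
    "\<forall>x. (g has_derivative (\<lambda>h. G x \<bullet> h)) (at x)" "\<forall>i\<in>Basis. Ck k (\<lambda>x. G x \<bullet> i)"
    by auto
  have "((\<lambda>x. f x * g x) has_derivative (\<lambda>h. (g x *\<^sub>R F x + f x *\<^sub>R G x) \<bullet> h)) (at x)" for x
    by (rule has_derivative_eq_rhs[OF has_derivative_mult[OF FG(1)[rule_format] FG(3)[rule_format]]])
      (auto simp: inner_add_left algebra_simps)
  moreover have "Ck k (\<lambda>x. (g x *\<^sub>R F x + f x *\<^sub>R G x) \<bullet> i)" if "i \<in> Basis" for i
    using that FG Suc.prems[THEN Ck_SucD] by (simp add: inner_add_left) (intro Ck_add Suc.IH; simp)
  ultimately show ?case by (auto intro!: exI[of _ "\<lambda>x. g x *\<^sub>R F x + f x *\<^sub>R G x"])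
qed

lemma Ck_prod: "finite I \<Longrightarrow> (\<And>i. i \<in> I \<Longrightarrow> Ck k (f i)) \<Longrightarrow> Ck k (\<lambda>x. \<Prod>i\<in>I. f i x)"
  by (induction I rule: finite_induct) (auto intro: Ck_const Ck_mult)

section \<open>Smooth bump functions on boxes\<close>

text \<open>
  The powers in the denominator make the span of these functions closed under differentiation.
\<close>

definition exp_flat :: "nat \<Rightarrow> real \<Rightarrow> real" where
  "exp_flat m y = (if y \<le> 0 then 0 else exp (- 1 / y) / y ^ m)"

lemma exp_ge_power_div_fact:
  fixes x :: real
  assumes "0 \<le> x"
  shows "x ^ n / fact n \<le> exp x"
proof -
  have "(\<Sum>k\<in>{n}. x ^ k /\<^sub>R fact k) \<le> (\<Sum>k. x ^ k /\<^sub>R fact k)"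
    using assms by (intro sum_le_suminf summable_exp_generic) auto
  then show ?thesis by (simp add: exp_def divide_inverse mult.commute)
qed

text \<open>The exponential dominates the power m + 2 of 1 / y. Of these factors m cancel the
  denominator and two are left over, so that even the difference quotient at 0 tends to 0.\<close>

lemma exp_flat_le_square: "\<bar>exp_flat m y\<bar> \<le> fact (m + 2) * y\<^sup>2"
proof (cases "y \<le> 0")
  case False
  then have y: "y > 0" by simp
  have "(1 / y) ^ (m + 2) / fact (m + 2) \<le> exp (1 / y)"
    using y exp_ge_power_div_fact[of "1 / y" "m + 2"] by simp
  then have "exp (- (1 / y)) \<le> fact (m + 2) * y ^ (m + 2)"
    using y by (simp add: exp_minus field_simps power_one_over del: fact_Suc)
  then show ?thesis using y
    by (simp add: exp_flat_def field_simps power_add power2_eq_square del: fact_Suc)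
qed (simp add: exp_flat_def)

text \<open>For y > 0 the chain rule contributes 1 / y^2 and the power contributes m / y, whence the
  indices m + 2 and m + 1. For y \<le> 0 every \<open>exp_flat\<close> is 0, so the same formula
  asserts derivative 0; only y = 0 needs an estimate.\<close>

lemma has_real_derivative_exp_flat:
  "(exp_flat m has_real_derivative exp_flat (m + 2) y - m * exp_flat (m + 1) y) (at y)"
proof -
  consider "y < 0" | "y = 0" | "y > 0" by linarith
  then show ?thesis
  proof cases
    case 1
    have "((\<lambda>y. 0) has_real_derivative 0) (at y)" by simp
    moreover have "eventually (\<lambda>x. 0 = exp_flat m x) (nhds y)"
      using eventually_nhds_in_open[of "{..<0}" y] 1 by (auto simp: exp_flat_def elim!: eventually_mono)
    ultimately have "(exp_flat m has_real_derivative 0) (at y)"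
      using DERIV_cong_ev[of y y "\<lambda>y. 0" "exp_flat m" 0 0] by simp
    then show ?thesis using 1 by (simp add: exp_flat_def)
  next
    case 2
    have "((\<lambda>h. (exp_flat m (0 + h) - exp_flat m 0) / h) \<longlongrightarrow> 0) (at 0)"
    proof (rule tendsto_rabs_zero_cancel, rule tendsto_sandwich[OF _ _ tendsto_const])
      show "\<forall>\<^sub>F h in at 0. \<bar>(exp_flat m (0 + h) - exp_flat m 0) / h\<bar> \<le> fact (m + 2) * \<bar>h\<bar>"
      proof (rule always_eventually, rule allI)
        fix h :: real
        show "\<bar>(exp_flat m (0 + h) - exp_flat m 0) / h\<bar> \<le> fact (m + 2) * \<bar>h\<bar>"
          using exp_flat_le_square[of m h]
          by (cases "h = 0") (simp_all add: exp_flat_def[of m 0] abs_divide field_simps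
              power2_eq_square abs_mult_self_eq del: fact_Suc)
      qed
      show "((\<lambda>h::real. fact (m + 2) * \<bar>h\<bar>) \<longlongrightarrow> 0) (at 0)"
        by (auto intro!: tendsto_eq_intros simp del: fact_Suc)
    qed simp
    then show ?thesis using 2 by (simp add: DERIV_def exp_flat_def[of _ 0])
  next
    case 3
    \<comment> \<open>The closing split on \<open>m\<close> is due to the truncated exponent m - 1
      in the derivative of \<open>y ^ m\<close>.\<close>
    have "((\<lambda>y. exp (- 1 / y) / y ^ m) has_real_derivative
      exp_flat (m + 2) y - m * exp_flat (m + 1) y) (at y)"
      using 3 by (auto intro!: derivative_eq_intros
          simp: exp_flat_def field_simps power2_eq_square power_add) (cases m; simp)
    moreover have "eventually (\<lambda>x. exp (- 1 / x) / x ^ m = exp_flat m x) (nhds y)"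
      using eventually_nhds_in_open[of "{0<..}" y] 3 by (auto simp: exp_flat_def elim!: eventually_mono)
    ultimately show ?thesis
      using DERIV_cong_ev[of y y "\<lambda>y. exp (- 1 / y) / y ^ m" "exp_flat m"] by blast
  qed
qed

text \<open>The induction must range over all \<open>m\<close>, since differentiating once replaces
  m by m + 2 and m + 1. The sign of \<open>c\<close> is free, so both faces of a box are
  covered.\<close>

lemma Ck_exp_flat_affine: "Ck k (\<lambda>x. exp_flat m (c * (x \<bullet> i) + a))"
proof (induction k arbitrary: m)
  have D: "((\<lambda>x. exp_flat m (c * (x \<bullet> i) + a)) has_derivative
     (\<lambda>h. ((c * (exp_flat (m + 2) (c * (x \<bullet> i) + a) - m * exp_flat (m + 1) (c * (x \<bullet> i) + a))) *\<^sub>R i) \<bullet> h))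
     (at x)" for m and x :: 'a
  proof -
    have "((\<lambda>x. c * (x \<bullet> i) + a) has_derivative (\<lambda>h. c * (h \<bullet> i))) (at x)"
      by (auto intro!: derivative_eq_intros)
    from has_derivative_compose[OF this
        has_real_derivative_exp_flat[THEN has_field_derivative_imp_has_derivative]]
    show ?thesis by (rule has_derivative_eq_rhs) (auto simp: inner_commute algebra_simps)
  qed
  {
    case 0
    then show ?case
      using has_derivative_continuous[OF D] by (simp add: continuous_at_imp_continuous_on)
  next
    case (Suc k)
    have "Ck k (\<lambda>x. (c * (exp_flat (m + 2) (c * (x \<bullet> i) + a) + (- m) * exp_flat (m + 1) (c * (x \<bullet> i) + a))) * (i \<bullet> j))" for j
      by (intro Ck_mult Ck_add Suc.IH Ck_const)
    with D show ?case
      by (auto intro!: exI[of _ "\<lambda>x. (c * (exp_flat (m + 2) (c * (x \<bullet> i) + a) - m * exp_flat (m + 1) (c * (x \<bullet> i) + a))) *\<^sub>R i"])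
  }
qed

text \<open>For each coordinate the two factors are positive exactly on the right sides of the two
  faces. The scaling by \<open>Suc n\<close> drives exp (- 1 / y) to 1 inside the box, so that the
  sequence approximates the indicator of the open box while the support never leaves the closed
  one.\<close>

definition box_bump :: "'a::euclidean_space \<Rightarrow> 'a \<Rightarrow> nat \<Rightarrow> 'a \<Rightarrow> real" where
  "box_bump a b n x =
     (\<Prod>i\<in>Basis. exp_flat 0 (Suc n * (x \<bullet> i - a \<bullet> i)) * exp_flat 0 (Suc n * (b \<bullet> i - x \<bullet> i)))"

lemma Ck_box_bump: "Ck k (box_bump a b n)"
proof -
  have "Ck k (\<lambda>x. \<Prod>i\<in>Basis. exp_flat 0 (Suc n * (x \<bullet> i) + (- Suc n * (a \<bullet> i)))
      * exp_flat 0 ((- real (Suc n)) * (x \<bullet> i) + Suc n * (b \<bullet> i)))"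
    by (intro Ck_prod Ck_mult Ck_exp_flat_affine) simp
  then show ?thesis
    by (simp add: box_bump_def[abs_def] algebra_simps)
qed

lemma box_bump_outside: "x \<notin> box a b \<Longrightarrow> box_bump a b n x = 0"
  by (auto simp: box_bump_def mem_box exp_flat_def not_less zero_le_mult_iff mult_le_0_iff)

lemma box_bump_bounds: "0 \<le> box_bump a b n x" "box_bump a b n x \<le> 1"
proof -
  have "0 \<le> exp_flat 0 y \<and> exp_flat 0 y \<le> 1" for y
    by (auto simp: exp_flat_def)
  then show "0 \<le> box_bump a b n x" "box_bump a b n x \<le> 1"
    unfolding box_bump_def by (auto intro!: prod_nonneg prod_le_1 mult_le_one)
qed

lemma box_bump_tendsto: "(\<lambda>n. box_bump a b n x) \<longlonglongrightarrow> indicator (box a b) x"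
proof (cases "x \<in> box a b")
  case True
  have flat: "(\<lambda>n. exp_flat 0 (Suc n * y)) \<longlonglongrightarrow> 1" if "y > 0" for y :: real
  proof -
    have "(\<lambda>n. exp (- (1 / real (Suc n)) * (1 / y))) \<longlonglongrightarrow> exp (- 0 * (1 / y))"
      using LIMSEQ_inverse_real_of_nat by (intro tendsto_intros) (simp add: inverse_eq_divide)
    then show ?thesis
      using that by (simp add: exp_flat_def mult_le_0_iff del: of_nat_Suc)
  qed
  have "(\<lambda>n. box_bump a b n x) \<longlonglongrightarrow> (\<Prod>i\<in>(Basis :: 'a set). 1 * 1)"
    unfolding box_bump_def using True by (intro tendsto_intros flat) (auto simp: mem_box)
  then show ?thesis using True by simp
qed (simp add: box_bump_outside)

lemma test_function_box_bump:
  assumes "cbox a b \<subseteq> U"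
  shows "test_function U (box_bump a b n)"
proof -
  have "closure {x. box_bump a b n x \<noteq> 0} \<subseteq> cbox a b"
    using box_bump_outside[of _ a b n] box_subset_cbox[of a b] by (intro closure_minimal) blast+
  with assms show ?thesis
    unfolding test_function_def
    by (meson Ck_box_bump bounded_cbox bounded_subset closed_closure compact_eq_bounded_closed order_trans)
qed

section \<open>From vanishing integrals to vanishing almost everywhere\<close>

text \<open>Since \<open>ennreal\<close> truncates at 0, the two densities are the positive and the
  negative part of \<open>f\<close>. The finite measures they define agree on boxes, an
  intersection-stable generator of the Borel sets, hence everywhere; so the two parts agree almost
  everywhere, which forces both to vanish.\<close>

lemma AE_eq_0_if_integral_box_eq_0:
  fixes f :: "'a::euclidean_space \<Rightarrow> real"
  assumes f: "integrable lborel f"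
    and eq: "\<And>a b. (LINT x:box a b|lborel. f x) = 0"
  shows "AE x in lborel. f x = 0"
proof -
  have fin: "(\<integral>\<^sup>+x. ennreal (f x) \<partial>lborel) < \<infinity>" "(\<integral>\<^sup>+x. ennreal (- f x) \<partial>lborel) < \<infinity>"
    using f by (auto simp: real_integrable_def less_top)
  have "density lborel (\<lambda>x. ennreal (f x)) = density lborel (\<lambda>x. ennreal (- f x))"
  proof (rule measure_eqI_generator_eq[where E="range (\<lambda>(a, b). box a b)" and \<Omega>=UNIV
        and A="\<lambda>n. box (- real n *\<^sub>R One) (real n *\<^sub>R One)"])
    fix X :: "'a set" assume "X \<in> range (\<lambda>(a, b). box a b)"
    then obtain a b where X: "X = box a b" by auto
    let ?g = "\<lambda>x. indicator (box a b) x * f x"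
    have g: "integrable lborel ?g"
      using integrable_mult_indicator[OF _ f, of "box a b"] by simp
    then have fing: "(\<integral>\<^sup>+x. ennreal (?g x) \<partial>lborel) < \<infinity>" "(\<integral>\<^sup>+x. ennreal (- ?g x) \<partial>lborel) < \<infinity>"
      by (auto simp: real_integrable_def less_top)
    have "enn2real (\<integral>\<^sup>+x. ennreal (?g x) \<partial>lborel) = enn2real (\<integral>\<^sup>+x. ennreal (- ?g x) \<partial>lborel)"
      using eq[of a b] real_lebesgue_integral_def[OF g] by (simp add: set_lebesgue_integral_def)
    then have "(\<integral>\<^sup>+x. ennreal (?g x) \<partial>lborel) = (\<integral>\<^sup>+x. ennreal (- ?g x) \<partial>lborel)"
      using fing by (metis ennreal_enn2real infinity_ennreal_def)
    moreover have "ennreal (?g x) = ennreal (f x) * indicator X x"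
      "ennreal (- ?g x) = ennreal (- f x) * indicator X x" for x
      by (auto simp: X indicator_def)
    ultimately show "emeasure (density lborel (\<lambda>x. ennreal (f x))) X
        = emeasure (density lborel (\<lambda>x. ennreal (- f x))) X"
      using f by (simp add: emeasure_density X)
  next
    fix n :: nat
    have "emeasure (density lborel (\<lambda>x. ennreal (f x))) (box (- real n *\<^sub>R One) (real n *\<^sub>R One))
        \<le> (\<integral>\<^sup>+x. ennreal (f x) \<partial>lborel)"
      using f by (auto simp: emeasure_density indicator_def intro!: nn_integral_mono)
    then show "emeasure (density lborel (\<lambda>x. ennreal (f x))) (box (- real n *\<^sub>R One) (real n *\<^sub>R One)) \<noteq> \<infinity>"
      using fin by (auto simp: top_unique)
  qed (auto simp: Int_stable_def box_Int_box borel_eq_box UN_box_eq_UNIV[simplified])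
  then have "AE x in lborel. ennreal (f x) = ennreal (- f x)"
    using f by (subst (asm) sigma_finite_measure.density_unique_iff[OF sigma_finite_lborel]) auto
  then show ?thesis
    by eventually_elim (metis ennreal_eq_0_iff ennreal_inj linear neg_0_le_iff_le
        neg_equal_zero neg_le_0_iff_le)
qed

text \<open>Dominated convergence along the bumps turns the hypothesis into vanishing integrals over
  all boxes whose closed box lies in \<Omega>. The previous lemma then applies to \<open>f\<close>
  cut off to one such box at a time.\<close>

lemma AE_eq_0_if_integral_test_function_eq_0:
  fixes f :: "'a::euclidean_space \<Rightarrow> real"
  assumes \<Omega>: "open \<Omega>" and f: "integrable (lebesgue_on \<Omega>) f"
    and eq: "\<And>\<phi>. test_function \<Omega> \<phi> \<Longrightarrow> (LINT x|lebesgue_on \<Omega>. f x * \<phi> x) = 0"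
  shows "AE x in lebesgue_on \<Omega>. f x = 0"
proof -
  have \<Omega>m: "\<Omega> \<in> sets lebesgue" using \<Omega> by auto
  have F: "integrable lebesgue (\<lambda>x. indicator \<Omega> x * f x)"
    using f \<Omega>m by (simp add: integrable_restrict_space)
  \<comment> \<open>The box lemma speaks about \<open>lborel\<close>, whereas \<open>f\<close> is
    only Lebesgue measurable; \<open>f'\<close> is a Borel version of \<open>f\<close> extended by
    0.\<close>
  then obtain f' where f'm: "f' \<in> borel_measurable lborel"
    and f': "AE x in lborel. indicator \<Omega> x * f x = f' x"
    using completion_ex_borel_measurable_real[of "\<lambda>x. indicator \<Omega> x * f x" lborel] by auto
  have f'L: "AE x in lebesgue. indicator \<Omega> x * f x = f' x"
    using f' by (rule AE_completion)
  have f'mL: "f' \<in> borel_measurable lebesgue" using f'm by (rule measurable_completion)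
  have "integrable lebesgue f'"
    using F f'L f'mL by (subst integrable_cong_AE[symmetric]) auto
  then have f'i: "integrable lborel f'" using f'm by (simp add: integrable_completion)
  have box0: "(LINT x:box a b|lborel. f' x) = 0" if ab: "cbox a b \<subseteq> \<Omega>" for a b
  proof -
    have z: "(LINT x|lborel. f' x * box_bump a b n x) = 0" for n
    proof -
      have bm: "box_bump a b n \<in> borel_measurable borel"
        using Ck_imp_continuous_on[OF Ck_box_bump] by (rule borel_measurable_continuous_onI)
      have "(LINT x|lborel. f' x * box_bump a b n x) = (LINT x|lebesgue. f' x * box_bump a b n x)"
        using f'm bm by (subst integral_completion) auto
      also have "\<dots> = (LINT x|lebesgue. indicator \<Omega> x *\<^sub>R (f x * box_bump a b n x))"
      proof (rule integral_cong_AE)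
        show "(\<lambda>x. f' x * box_bump a b n x) \<in> borel_measurable lebesgue"
          using f'm bm by (intro measurable_completion) auto
        have "box_bump a b n \<in> borel_measurable lebesgue"
          using bm by (intro measurable_completion) simp
        from borel_measurable_times[OF borel_measurable_integrable[OF F] this]
        show "(\<lambda>x. indicator \<Omega> x *\<^sub>R (f x * box_bump a b n x)) \<in> borel_measurable lebesgue"
          by (simp add: mult.assoc)
      qed (use f'L in eventually_elim, auto)
      also have "\<dots> = (LINT x|lebesgue_on \<Omega>. f x * box_bump a b n x)"
        using \<Omega>m by (simp add: integral_restrict_space)
      also have "\<dots> = 0" by (intro eq test_function_box_bump ab)
      finally show ?thesis .
    qed
    have "(\<lambda>n. LINT x|lborel. f' x * box_bump a b n x) \<longlonglongrightarrow> (LINT x|lborel. f' x * indicator (box a b) x)"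
    proof (rule integral_dominated_convergence[where w="\<lambda>x. \<bar>f' x\<bar>"])
      show "(\<lambda>x. f' x * box_bump a b n x) \<in> borel_measurable lborel" for n
        using Ck_imp_continuous_on[OF Ck_box_bump[of 0 a b n], THEN borel_measurable_continuous_onI] f'm
        by auto
      show "AE x in lborel. norm (f' x * box_bump a b n x) \<le> \<bar>f' x\<bar>" for n
        using box_bump_bounds[of a b n] by (auto simp: abs_mult intro!: mult_left_le)
    qed (use f'i f'm in \<open>auto intro!: tendsto_intros box_bump_tendsto\<close>)
    then show ?thesis
      using z by (simp add: LIMSEQ_const_iff set_lebesgue_integral_def mult.commute)
  qed
  have zero: "AE x in lborel. x \<in> box a b \<longrightarrow> f' x = 0" if ab: "cbox a b \<subseteq> \<Omega>" for a b
  proof -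
    have "AE x in lborel. indicator (box a b) x * f' x = 0"
    proof (rule AE_eq_0_if_integral_box_eq_0)
      show "integrable lborel (\<lambda>x. indicator (box a b) x * f' x)"
        using integrable_mult_indicator[OF _ f'i, of "box a b"] by simp
      fix c d :: 'a
      obtain p q where pq: "box c d \<inter> box a b = box p q" using box_Int_box by blast
      \<comment> \<open>A nonempty \<open>box p q\<close> has closure \<open>cbox p q\<close>, which
        therefore stays in \<Omega>. If the box is empty, \<open>cbox p q\<close> need not lie in
        \<Omega>, but then the integral is 0 anyway.\<close>
      have "closure (box p q) \<subseteq> cbox a b"
        using pq box_subset_cbox[of a b] by (intro closure_minimal) auto
      then have "cbox p q \<subseteq> \<Omega> \<or> box p q = {}"
        using ab closure_box[of p q] by (cases "box p q = {}") simp_all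
      then have "(LINT x:box p q|lborel. f' x) = 0"
        using box0 by (auto simp: set_lebesgue_integral_def)
      then show "(LINT x:box c d|lborel. indicator (box a b) x * f' x) = 0"
        by (simp add: set_lebesgue_integral_def pq[symmetric] indicator_inter_arith mult.assoc)
    qed
    then show ?thesis by eventually_elim (auto simp: indicator_def)
  qed
  \<comment> \<open>Almost everywhere statements combine over countably many boxes only; Lindelof
    supplies a countable cover of \<Omega>.\<close>
  obtain D where D: "countable D" "\<And>B. B \<in> D \<Longrightarrow> \<exists>a b. B = box a b \<and> cbox a b \<subseteq> \<Omega>" "\<Union>D = \<Omega>"
  proof -
    have "\<Union>{box a b |a b. cbox a b \<subseteq> \<Omega>} = \<Omega>"
    proof (intro equalityI subsetI)
      fix x assume "x \<in> \<Omega>"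
      then obtain a b where "cbox a b \<subseteq> \<Omega>" "x \<in> box a b"
        using open_contains_cbox[OF \<Omega>] by metis
      then show "x \<in> \<Union>{box a b |a b. cbox a b \<subseteq> \<Omega>}" by auto
    qed (use box_subset_cbox in blast)
    moreover obtain D where "D \<subseteq> {box a b |a b. cbox a b \<subseteq> \<Omega>}" "countable D"
      "\<Union>D = \<Union>{box a b |a b. cbox a b \<subseteq> \<Omega>}"
      by (rule Lindelof[of "{box a b |a b. cbox a b \<subseteq> \<Omega>}"]) (auto intro: open_box)
    ultimately show ?thesis by (intro that[of D]) auto
  qed
  have "AE x in lborel. \<forall>B\<in>D. x \<in> B \<longrightarrow> f' x = 0"
    using D zero by (subst AE_ball_countable) blast+
  then have "AE x in lborel. x \<in> \<Omega> \<longrightarrow> f' x = 0"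
    by eventually_elim (use D(3) in blast)
  with f' have "AE x in lborel. x \<in> \<Omega> \<longrightarrow> f x = 0"
    by eventually_elim auto
  then show ?thesis
    using \<Omega>m by (subst AE_restrict_space_iff) (auto intro: AE_completion)
qed

section \<open>Seminormed function spaces\<close>

text \<open>Common ground of \<open>L2\<close>, \<open>H1\<close> and \<open>H1_dual\<close>, so
  that the Bochner space lemmas are proved once. For the dual, the underlying set \<open>'s\<close>
  is itself a type of functions. Definiteness is absent because representatives may differ on null
  sets.\<close>

locale function_seminorm =
  fixes X :: "('s \<Rightarrow> real) set" and N :: "('s \<Rightarrow> real) \<Rightarrow> real"
  assumes lincomb: "u \<in> X \<Longrightarrow> v \<in> X \<Longrightarrow> (\<lambda>x. c * u x + d * v x) \<in> X"
    and nonneg: "u \<in> X \<Longrightarrow> 0 \<le> N u"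
    and scale: "u \<in> X \<Longrightarrow> N (\<lambda>x. c * u x) = \<bar>c\<bar> * N u"
    and triangle: "u \<in> X \<Longrightarrow> v \<in> X \<Longrightarrow> N (\<lambda>x. u x + v x) \<le> N u + N v"
begin

lemma scale_closed: "u \<in> X \<Longrightarrow> (\<lambda>x. c * u x) \<in> X"
  using lincomb[of u u c 0] by simp

lemma diff_closed: "u \<in> X \<Longrightarrow> v \<in> X \<Longrightarrow> (\<lambda>x. u x - v x) \<in> X"
  using lincomb[of u v 1 "-1"] by simp

lemma norm_lincomb_le:
  assumes "u \<in> X" "v \<in> X"
  shows "N (\<lambda>x. c * u x + d * v x) \<le> \<bar>c\<bar> * N u + \<bar>d\<bar> * N v"
  using triangle[OF scale_closed[OF assms(1)] scale_closed[OF assms(2)], of c d] assms by (simp add: scale)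

lemma abs_norm_diff_le:
  assumes "u \<in> X" "v \<in> X"
  shows "\<bar>N u - N v\<bar> \<le> N (\<lambda>x. u x - v x)"
proof -
  have "N u \<le> N (\<lambda>x. u x - v x) + N v"
    using triangle[OF diff_closed[OF assms] assms(2)] by simp
  moreover have "N v \<le> N (\<lambda>x. u x - v x) + N u"
    using triangle[OF scale_closed[OF diff_closed[OF assms]] assms(1), of "-1"] scale[OF diff_closed[OF assms], of "-1"]
    by simp
  ultimately show ?thesis by simp
qed

end

text \<open>The discriminant argument for a form that is only semidefinite, which makes A = 0 a
  genuine case.\<close>

lemma binary_form_Cauchy_Schwarz:
  fixes A B C :: real
  assumes pos: "\<And>c d. 0 \<le> c\<^sup>2 * A + 2 * c * d * B + d\<^sup>2 * C"
  shows "B\<^sup>2 \<le> A * C"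
proof -
  have A: "0 \<le> A" using pos[of 1 0] by simp
  show ?thesis
  proof (cases "A = 0")
    case True
    have "B = 0"
    proof (rule ccontr)
      assume "B \<noteq> 0"
      \<comment> \<open>With A = 0 and d = 1 the form is the affine function 2 c B + C of c; the
        chosen c gives it the value -1.\<close>
      then show False using pos[of "- (C + 1) / (2 * B)" 1] True by (simp add: field_simps)
    qed
    then show ?thesis using True by simp
  next
    case False
    \<comment> \<open>The pair (B, -A) is proportional to the minimiser of the form for fixed
      d.\<close>
    have "0 \<le> A * (A * C - B\<^sup>2)" using pos[of B "- A"] by (simp add: power2_eq_square algebra_simps)
    then show ?thesis using A False by (simp add: zero_le_mult_iff)
  qed
qed

locale semi_inner_product =
  fixes X :: "('s \<Rightarrow> real) set" and B :: "('s \<Rightarrow> real) \<Rightarrow> ('s \<Rightarrow> real) \<Rightarrow> real"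
  assumes closed: "u \<in> X \<Longrightarrow> v \<in> X \<Longrightarrow> (\<lambda>x. c * u x + d * v x) \<in> X"
    and linear_left: "u \<in> X \<Longrightarrow> v \<in> X \<Longrightarrow> w \<in> X \<Longrightarrow> B (\<lambda>x. c * u x + d * v x) w = c * B u w + d * B v w"
    and commute: "u \<in> X \<Longrightarrow> v \<in> X \<Longrightarrow> B u v = B v u"
    and pos: "u \<in> X \<Longrightarrow> 0 \<le> B u u"
begin

lemma lincomb_self:
  assumes "u \<in> X" "v \<in> X"
  shows "B (\<lambda>x. c * u x + d * v x) (\<lambda>x. c * u x + d * v x)
    = c\<^sup>2 * B u u + 2 * c * d * B u v + d\<^sup>2 * B v v"
proof -
  let ?w = "\<lambda>x. c * u x + d * v x"
  have "B w ?w = c * B w u + d * B w v" if "w \<in> X" for w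
    using assms that closed[OF assms, of c d] commute[OF that] linear_left[OF assms that] by auto
  then show ?thesis
    using assms linear_left[OF assms closed[OF assms]] commute[OF assms]
    by (simp add: power2_eq_square algebra_simps)
qed

lemma Cauchy_Schwarz:
  assumes "u \<in> X" "v \<in> X"
  shows "\<bar>B u v\<bar> \<le> sqrt (B u u) * sqrt (B v v)"
proof -
  have "(B u v)\<^sup>2 \<le> B u u * B v v"
    using pos[OF closed[OF assms]] by (intro binary_form_Cauchy_Schwarz) (simp add: lincomb_self[OF assms])
  then show ?thesis
    using real_sqrt_le_mono by (fastforce simp: real_sqrt_mult)
qed

sublocale function_seminorm X "\<lambda>u. sqrt (B u u)"
proof
  fix u v c assume uv: "u \<in> X" "v \<in> X"
  show "sqrt (B (\<lambda>x. u x + v x) (\<lambda>x. u x + v x)) \<le> sqrt (B u u) + sqrt (B v v)"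
  proof (rule real_le_lsqrt)
    show "B (\<lambda>x. u x + v x) (\<lambda>x. u x + v x) \<le> (sqrt (B u u) + sqrt (B v v))\<^sup>2"
      using Cauchy_Schwarz[OF uv] lincomb_self[OF uv, of 1 1] pos uv
      by (simp add: power2_sum)
  qed (use pos uv in auto)
next
  fix u c assume "u \<in> X"
  then show "sqrt (B (\<lambda>x. c * u x) (\<lambda>x. c * u x)) = \<bar>c\<bar> * sqrt (B u u)"
    using lincomb_self[of u u c 0] by (simp add: real_sqrt_mult)
qed (use closed pos in auto)

end

section \<open>Square integrable functions\<close>

lemma L2_mult_integrable:
  assumes "f \<in> L2 \<mu>" "g \<in> L2 \<mu>"
  shows "integrable \<mu> (\<lambda>x. f x * g x)"
proof (rule Bochner_Integration.integrable_bound)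
  show "integrable \<mu> (\<lambda>x. (f x)\<^sup>2 + (g x)\<^sup>2)" using assms by (auto simp: L2_def)
  show "(\<lambda>x. f x * g x) \<in> borel_measurable \<mu>" using assms by (auto simp: L2_def)
  have "\<bar>a * b\<bar> \<le> a\<^sup>2 + b\<^sup>2" for a b :: real
    using sum_squares_bound[of "\<bar>a\<bar>" "\<bar>b\<bar>"] abs_ge_zero[of "a * b"]
    unfolding abs_mult power2_abs by linarith
  then show "AE x in \<mu>. norm (f x * g x) \<le> norm ((f x)\<^sup>2 + (g x)\<^sup>2)" by auto
qed

lemma L2_lincomb:
  assumes "f \<in> L2 \<mu>" "g \<in> L2 \<mu>"
  shows "(\<lambda>x. c * f x + d * g x) \<in> L2 \<mu>"
proof -
  have "integrable \<mu> (\<lambda>x. c\<^sup>2 * (f x)\<^sup>2 + 2 * c * d * (f x * g x) + d\<^sup>2 * (g x)\<^sup>2)"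
    using assms L2_mult_integrable[OF assms] by (auto simp: L2_def)
  then have "integrable \<mu> (\<lambda>x. (c * f x + d * g x)\<^sup>2)"
    by (simp add: power2_eq_square algebra_simps)
  then show ?thesis using assms by (auto simp: L2_def)
qed

lemma L2_norm_altdef: "L2_norm \<mu> f = sqrt (L2_inner \<mu> f f)"
  by (simp add: L2_norm_def L2_inner_def power2_eq_square)

text \<open>The inherited norm occurs both as an abstraction and applied to an argument, hence two
  rewrites into \<open>L2_norm\<close>.\<close>

global_interpretation L2: semi_inner_product "L2 \<mu>" "L2_inner \<mu>"
  rewrites "(\<lambda>u. sqrt (L2_inner \<mu> u u)) = L2_norm \<mu>" and "sqrt (L2_inner \<mu> u u) = L2_norm \<mu> u"
    for \<mu> :: "'a measure" and u
proof -
  show "semi_inner_product (L2 \<mu>) (L2_inner \<mu>)"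
  proof
    fix u v w c d assume uvw: "u \<in> L2 \<mu>" "v \<in> L2 \<mu>" "w \<in> L2 \<mu>"
    show "L2_inner \<mu> (\<lambda>x. c * u x + d * v x) w = c * L2_inner \<mu> u w + d * L2_inner \<mu> v w"
      using L2_mult_integrable[OF uvw(1,3)] L2_mult_integrable[OF uvw(2,3)]
      by (simp add: L2_inner_def distrib_right mult.assoc)
  qed (auto simp: L2_inner_def L2_lincomb mult.commute)
qed (auto simp: L2_norm_altdef)

lemma L2_norm_nonneg: "0 \<le> L2_norm \<mu> f"
  by (simp add: L2_norm_def)

lemma L2_const:
  assumes "finite_measure \<mu>"
  shows "(\<lambda>x. c) \<in> L2 \<mu>"
  using assms by (simp add: L2_def finite_measure.integrable_const)

lemma L2_imp_integrable:
  assumes "finite_measure \<mu>" "f \<in> L2 \<mu>"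
  shows "integrable \<mu> f"
  using L2_mult_integrable[OF assms(2) L2_const[OF assms(1), of 1]] by simp

lemma finite_measure_lebesgue_on_bounded:
  assumes "bounded S" "S \<in> sets lebesgue"
  shows "finite_measure (lebesgue_on S)"
  using assms by (intro finite_measure_lebesgue_on bounded_set_imp_lmeasurable)

lemma L2_compact_support:
  fixes f :: "'a::euclidean_space \<Rightarrow> real"
  assumes f: "continuous_on UNIV f" and K: "compact K" "{x. f x \<noteq> 0} \<subseteq> K" and S: "S \<in> sets lebesgue"
  shows "f \<in> L2 (lebesgue_on S)"
proof -
  have m: "f \<in> borel_measurable borel" using f by (rule borel_measurable_continuous_onI)
  have "integrable lborel (\<lambda>x. indicator K x *\<^sub>R (f x)\<^sup>2)"
    using K f by (intro borel_integrable_compact continuous_intros) (auto intro: continuous_on_subset)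
  also have "(\<lambda>x. indicator K x *\<^sub>R (f x)\<^sup>2) = (\<lambda>x. (f x)\<^sup>2)"
    using K by (auto simp: indicator_def fun_eq_iff)
  finally have "integrable lebesgue (\<lambda>x. (f x)\<^sup>2)"
    using m by (subst integrable_completion) auto
  from integrable_mult_indicator[OF S this] have "integrable (lebesgue_on S) (\<lambda>x. (f x)\<^sup>2)"
    using S by (subst integrable_restrict_space) auto
  moreover have "f \<in> borel_measurable (lebesgue_on S)"
    using m by (intro measurable_restrict_space1 measurable_completion) simp
  ultimately show ?thesis by (simp add: L2_def)
qed

lemma test_function_imp_L2:
  "test_function U \<phi> \<Longrightarrow> S \<in> sets lebesgue \<Longrightarrow> \<phi> \<in> L2 (lebesgue_on S)"
  unfolding test_function_def
  by (rule L2_compact_support[where K="closure {x. \<phi> x \<noteq> 0}"]) (auto intro: Ck_imp_continuous_on closure_subset[THEN subsetD])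

text \<open>Off the closure of its support \<phi> is locally 0, so its derivative vanishes there.
  This gives the partial derivatives compact support and makes them square integrable.\<close>

lemma test_function_derivative:
  assumes \<phi>: "test_function U \<phi>"
  obtains F where "\<And>x. (\<phi> has_derivative (\<lambda>h. F x \<bullet> h)) (at x)"
    and "\<And>i. i \<in> Basis \<Longrightarrow> continuous_on UNIV (\<lambda>x. F x \<bullet> i)"
    and "\<And>x. x \<notin> closure {x. \<phi> x \<noteq> 0} \<Longrightarrow> F x = 0"
proof -
  from \<phi> have "Ck (Suc 0) \<phi>" unfolding test_function_def by blast
  then obtain F where F: "\<And>x. (\<phi> has_derivative (\<lambda>h. F x \<bullet> h)) (at x)"
    "\<And>i. i \<in> Basis \<Longrightarrow> continuous_on UNIV (\<lambda>x. F x \<bullet> i)" by auto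
  have "F x = 0" if x: "x \<notin> closure {x. \<phi> x \<noteq> 0}" for x
  proof -
    have "((\<lambda>x. 0) has_derivative (\<lambda>h. 0)) (at x)" by simp
    then have "(\<phi> has_derivative (\<lambda>h. 0)) (at x)"
      by (rule has_derivative_transform_within_open[where s="- closure {x. \<phi> x \<noteq> 0}"])
        (use x closure_subset[of "{x. \<phi> x \<noteq> 0}"] in auto)
    from has_derivative_unique[OF F(1) this] have "F x \<bullet> F x = 0" by metis
    then show ?thesis by simp
  qed
  with F show thesis by (rule that)
qed

lemma test_function_frechet_derivative_L2:
  assumes \<phi>: "test_function U \<phi>" and i: "i \<in> Basis" and S: "S \<in> sets lebesgue"
  shows "(\<lambda>x. frechet_derivative \<phi> (at x) i) \<in> L2 (lebesgue_on S)"
proof -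
  obtain F where F: "\<And>x. (\<phi> has_derivative (\<lambda>h. F x \<bullet> h)) (at x)"
    "\<And>i. i \<in> Basis \<Longrightarrow> continuous_on UNIV (\<lambda>x. F x \<bullet> i)"
    "\<And>x. x \<notin> closure {x. \<phi> x \<noteq> 0} \<Longrightarrow> F x = 0"
    using test_function_derivative[OF \<phi>] by metis
  have "frechet_derivative \<phi> (at x) i = F x \<bullet> i" for x
    using frechet_derivative_at[OF F(1)[of x]] by metis
  moreover have "(\<lambda>x. F x \<bullet> i) \<in> L2 (lebesgue_on S)"
    using \<phi> F i S unfolding test_function_def
    by (intro L2_compact_support[where K="closure {x. \<phi> x \<noteq> 0}"]) (auto, metis inner_zero_left)
  ultimately show ?thesis by simp
qed

section \<open>Weak gradients and the space \<open>H\<^sup>1\<close>\<close>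

lemma weak_gradient_lincomb:
  assumes \<Omega>: "\<Omega> \<in> sets lebesgue" and f: "f \<in> L2 (lebesgue_on \<Omega>)" "weak_gradient \<Omega> f F"
    and g: "g \<in> L2 (lebesgue_on \<Omega>)" "weak_gradient \<Omega> g G"
  shows "weak_gradient \<Omega> (\<lambda>x. c * f x + d * g x) (\<lambda>x. c *\<^sub>R F x + d *\<^sub>R G x)"
  unfolding weak_gradient_def
proof (intro conjI ballI allI impI)
  fix i :: 'a assume i: "i \<in> Basis"
  have Fi: "(\<lambda>x. F x \<bullet> i) \<in> L2 (lebesgue_on \<Omega>)" and Gi: "(\<lambda>x. G x \<bullet> i) \<in> L2 (lebesgue_on \<Omega>)"
    using f g i by (auto simp: weak_gradient_def)
  from L2_lincomb[OF this] show "(\<lambda>x. (c *\<^sub>R F x + d *\<^sub>R G x) \<bullet> i) \<in> L2 (lebesgue_on \<Omega>)"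
    by (simp add: inner_add_left)
  fix \<phi> assume \<phi>: "test_function \<Omega> \<phi>"
  note [simp] = L2_mult_integrable[OF f(1) test_function_frechet_derivative_L2[OF \<phi> i \<Omega>]]
    L2_mult_integrable[OF g(1) test_function_frechet_derivative_L2[OF \<phi> i \<Omega>]]
    L2_mult_integrable[OF Fi test_function_imp_L2[OF \<phi> \<Omega>]] L2_mult_integrable[OF Gi test_function_imp_L2[OF \<phi> \<Omega>]]
  show "(LINT x|lebesgue_on \<Omega>. (c * f x + d * g x) * frechet_derivative \<phi> (at x) i) =
        - (LINT x|lebesgue_on \<Omega>. ((c *\<^sub>R F x + d *\<^sub>R G x) \<bullet> i) * \<phi> x)"
    using f(2) g(2) \<phi> i
    by (simp add: weak_gradient_def inner_add_left distrib_right mult.assoc)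
qed

text \<open>Componentwise, the difference of two weak gradients is orthogonal to all test functions.
  Boundedness of \<Omega> puts the square integrable components into L^1, where the fundamental
  lemma applies.\<close>

lemma weak_gradient_unique:
  assumes \<Omega>: "open \<Omega>" "bounded \<Omega>" and F: "weak_gradient \<Omega> f F" and G: "weak_gradient \<Omega> f G"
  shows "AE x in lebesgue_on \<Omega>. F x = G x"
proof -
  have \<Omega>m: "\<Omega> \<in> sets lebesgue" using \<Omega> by auto
  have "AE x in lebesgue_on \<Omega>. F x \<bullet> i - G x \<bullet> i = 0" if i: "i \<in> Basis" for i
  proof (rule AE_eq_0_if_integral_test_function_eq_0[OF \<Omega>(1)])
    have Fi: "(\<lambda>x. F x \<bullet> i) \<in> L2 (lebesgue_on \<Omega>)" and Gi: "(\<lambda>x. G x \<bullet> i) \<in> L2 (lebesgue_on \<Omega>)"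
      using F G i by (auto simp: weak_gradient_def)
    then show "integrable (lebesgue_on \<Omega>) (\<lambda>x. F x \<bullet> i - G x \<bullet> i)"
      using finite_measure_lebesgue_on_bounded[OF \<Omega>(2) \<Omega>m] by (auto intro: L2_imp_integrable)
    fix \<phi> assume \<phi>: "test_function \<Omega> \<phi>"
    have "(LINT x|lebesgue_on \<Omega>. (F x \<bullet> i) * \<phi> x) = (LINT x|lebesgue_on \<Omega>. (G x \<bullet> i) * \<phi> x)"
      using F G \<phi> i by (simp add: weak_gradient_def)
    then show "(LINT x|lebesgue_on \<Omega>. (F x \<bullet> i - G x \<bullet> i) * \<phi> x) = 0"
      using L2_mult_integrable[OF Fi test_function_imp_L2[OF \<phi> \<Omega>m]]
        L2_mult_integrable[OF Gi test_function_imp_L2[OF \<phi> \<Omega>m]] by (simp add: left_diff_distrib)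
  qed
  then have "AE x in lebesgue_on \<Omega>. \<forall>i\<in>Basis. F x \<bullet> i - G x \<bullet> i = 0"
    by (intro AE_finite_allI) auto
  then show ?thesis by eventually_elim (auto intro: euclidean_eqI)
qed

lemma weak_gradient_grad: "f \<in> H1 \<Omega> \<Longrightarrow> weak_gradient \<Omega> f (grad \<Omega> f)"
  unfolding H1_def grad_def using someI_ex[of "weak_gradient \<Omega> f"] by blast

lemma H1_lincomb:
  "\<Omega> \<in> sets lebesgue \<Longrightarrow> f \<in> H1 \<Omega> \<Longrightarrow> g \<in> H1 \<Omega> \<Longrightarrow> (\<lambda>x. c * f x + d * g x) \<in> H1 \<Omega>"
  unfolding H1_def by (auto intro!: L2_lincomb dest: weak_gradient_lincomb)

lemma H1_subset_L2: "f \<in> H1 \<Omega> \<Longrightarrow> f \<in> L2 (lebesgue_on \<Omega>)"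
  by (simp add: H1_def)

lemma grad_lincomb:
  assumes \<Omega>: "open \<Omega>" "bounded \<Omega>" and f: "f \<in> H1 \<Omega>" and g: "g \<in> H1 \<Omega>"
  shows "AE x in lebesgue_on \<Omega>. grad \<Omega> (\<lambda>x. c * f x + d * g x) x = c *\<^sub>R grad \<Omega> f x + d *\<^sub>R grad \<Omega> g x"
  using \<Omega> by (intro weak_gradient_unique[OF \<Omega> weak_gradient_grad weak_gradient_lincomb] H1_lincomb
      H1_subset_L2 f g weak_gradient_grad) auto

definition dirichlet_form :: "'a::euclidean_space set \<Rightarrow> ('a \<Rightarrow> real) \<Rightarrow> ('a \<Rightarrow> real) \<Rightarrow> real" where
  "dirichlet_form \<Omega> u v = (LINT x|lebesgue_on \<Omega>. grad \<Omega> u x \<bullet> grad \<Omega> v x)"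

lemma grad_inner_integrable:
  assumes "u \<in> H1 \<Omega>" "v \<in> H1 \<Omega>"
  shows "integrable (lebesgue_on \<Omega>) (\<lambda>x. grad \<Omega> u x \<bullet> grad \<Omega> v x)"
  using assms[THEN weak_gradient_grad]
  by (subst euclidean_inner) (auto intro!: Bochner_Integration.integrable_sum L2_mult_integrable simp: weak_gradient_def)

lemma dirichlet_form_lincomb:
  assumes \<Omega>: "open \<Omega>" "bounded \<Omega>" and uv: "u \<in> H1 \<Omega>" "v \<in> H1 \<Omega>" and w: "w \<in> H1 \<Omega>"
  shows "dirichlet_form \<Omega> (\<lambda>x. c * u x + d * v x) w = c * dirichlet_form \<Omega> u w + d * dirichlet_form \<Omega> v w"
proof -
  have \<Omega>m: "\<Omega> \<in> sets lebesgue" using \<Omega> by auto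
  note int = grad_inner_integrable[OF uv(1) w] grad_inner_integrable[OF uv(2) w]
  have "dirichlet_form \<Omega> (\<lambda>x. c * u x + d * v x) w =
      (LINT x|lebesgue_on \<Omega>. c * (grad \<Omega> u x \<bullet> grad \<Omega> w x) + d * (grad \<Omega> v x \<bullet> grad \<Omega> w x))"
    unfolding dirichlet_form_def
  proof (rule integral_cong_AE)
    show "(\<lambda>x. grad \<Omega> (\<lambda>x. c * u x + d * v x) x \<bullet> grad \<Omega> w x) \<in> borel_measurable (lebesgue_on \<Omega>)"
      using grad_inner_integrable[OF H1_lincomb[OF \<Omega>m uv] w] by (rule borel_measurable_integrable)
    show "(\<lambda>x. c * (grad \<Omega> u x \<bullet> grad \<Omega> w x) + d * (grad \<Omega> v x \<bullet> grad \<Omega> w x)) \<in> borel_measurable (lebesgue_on \<Omega>)"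
      using int[THEN borel_measurable_integrable] by (intro borel_measurable_add borel_measurable_times) auto
    show "AE x in lebesgue_on \<Omega>. grad \<Omega> (\<lambda>x. c * u x + d * v x) x \<bullet> grad \<Omega> w x =
        c * (grad \<Omega> u x \<bullet> grad \<Omega> w x) + d * (grad \<Omega> v x \<bullet> grad \<Omega> w x)"
      using grad_lincomb[OF \<Omega> uv, of c d] by eventually_elim (simp add: inner_add_left)
  qed
  then show ?thesis using int by (simp add: dirichlet_form_def)
qed

text \<open>Its diagonal is the square of \<open>H1_norm\<close>, so the triangle inequality for
  that norm comes from Cauchy-Schwarz.\<close>

definition H1_inner :: "'a::euclidean_space set \<Rightarrow> ('a \<Rightarrow> real) \<Rightarrow> ('a \<Rightarrow> real) \<Rightarrow> real" where
  "H1_inner \<Omega> u v = L2_inner (lebesgue_on \<Omega>) u v + dirichlet_form \<Omega> u v"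

lemma L2_norm_power2: "(L2_norm \<mu> f)\<^sup>2 = L2_inner \<mu> f f"
  by (auto simp: L2_norm_altdef L2_inner_def)

lemma H1_norm_altdef: "H1_norm \<Omega> u = sqrt (H1_inner \<Omega> u u)"
  by (simp add: H1_norm_def H1_inner_def dirichlet_form_def L2_norm_power2 power2_norm_eq_inner)

lemma semi_inner_product_H1:
  assumes \<Omega>: "open \<Omega>" "bounded \<Omega>"
  shows "semi_inner_product (H1 \<Omega>) (H1_inner \<Omega>)"
proof
  have \<Omega>m: "\<Omega> \<in> sets lebesgue" using \<Omega> by auto
  show "(\<lambda>x. c * u x + d * v x) \<in> H1 \<Omega>" if "u \<in> H1 \<Omega>" "v \<in> H1 \<Omega>" for u v c d
    using \<Omega>m that by (rule H1_lincomb)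
  show "H1_inner \<Omega> (\<lambda>x. c * u x + d * v x) w = c * H1_inner \<Omega> u w + d * H1_inner \<Omega> v w"
    if "u \<in> H1 \<Omega>" "v \<in> H1 \<Omega>" "w \<in> H1 \<Omega>" for u v w c d
    using that \<Omega> by (simp add: H1_inner_def dirichlet_form_lincomb H1_subset_L2 L2.linear_left algebra_simps)
qed (auto simp: H1_inner_def L2_inner_def dirichlet_form_def inner_commute mult.commute
    intro!: add_nonneg_nonneg integral_nonneg)

lemma function_seminorm_H1:
  assumes "open \<Omega>" "bounded \<Omega>"
  shows "function_seminorm (H1 \<Omega>) (H1_norm \<Omega>)"
proof -
  interpret semi_inner_product "H1 \<Omega>" "H1_inner \<Omega>" using assms by (rule semi_inner_product_H1)
  show ?thesis using function_seminorm_axioms by (simp flip: H1_norm_altdef)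
qed

lemma H1_norm_nonneg: "0 \<le> H1_norm \<Omega> u"
  by (simp add: H1_norm_def)

lemma L2_norm_le_H1_norm: "L2_norm (lebesgue_on \<Omega>) u \<le> H1_norm \<Omega> u"
  unfolding H1_norm_def by (intro real_le_rsqrt) (simp add: integral_nonneg)

lemma H1_zero: "(\<lambda>x. 0) \<in> H1 \<Omega>"
  by (auto simp: H1_def L2_def weak_gradient_def intro!: exI[of _ "\<lambda>x. 0"])

lemma H1_norm_zero:
  assumes "open \<Omega>" "bounded \<Omega>"
  shows "H1_norm \<Omega> (\<lambda>x. 0) = 0"
  using function_seminorm.scale[OF function_seminorm_H1[OF assms] H1_zero, of 0] by simp

text \<open>A real supremum is informative only for sets bounded above, so every use of
  \<open>H1_dual_norm\<close> rests on this. The constant in \<open>H1_dual\<close> may be negative,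
  hence the absolute value in the bound.\<close>

lemma H1_dual_bdd_above:
  assumes "F \<in> H1_dual \<Omega>"
  shows "bdd_above ((\<lambda>v. \<bar>F v\<bar>) ` {v \<in> H1 \<Omega>. H1_norm \<Omega> v \<le> 1})"
proof -
  from assms obtain C where C: "\<And>v. v \<in> H1 \<Omega> \<Longrightarrow> \<bar>F v\<bar> \<le> C * H1_norm \<Omega> v"
    unfolding H1_dual_def by blast
  show ?thesis
  proof (rule bdd_aboveI2)
    fix v assume v: "v \<in> {v \<in> H1 \<Omega>. H1_norm \<Omega> v \<le> 1}"
    then have "\<bar>F v\<bar> \<le> C * H1_norm \<Omega> v" using C by blast
    also have "\<dots> \<le> \<bar>C\<bar> * 1" using v by (intro mult_mono) (auto simp: H1_norm_nonneg)
    finally show "\<bar>F v\<bar> \<le> \<bar>C\<bar>" by simp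
  qed
qed

text \<open>Vectors of positive norm are normalised; on the kernel of the seminorm, where that
  fails, boundedness makes \<open>F\<close> vanish.\<close>

lemma H1_dual_le:
  assumes "open \<Omega>" "bounded \<Omega>" and F: "F \<in> H1_dual \<Omega>" and v: "v \<in> H1 \<Omega>"
  shows "\<bar>F v\<bar> \<le> H1_dual_norm \<Omega> F * H1_norm \<Omega> v"
proof -
  interpret function_seminorm "H1 \<Omega>" "H1_norm \<Omega>" using assms by (intro function_seminorm_H1)
  show ?thesis
  proof (cases "H1_norm \<Omega> v = 0")
    case True
    then show ?thesis using F v by (force simp: H1_dual_def)
  next
    case False
    then have pos: "H1_norm \<Omega> v > 0" using nonneg[OF v] by simp
    let ?w = "\<lambda>x. (1 / H1_norm \<Omega> v) * v x"
    have w: "?w \<in> H1 \<Omega>" using scale_closed[OF v] .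
    moreover have "H1_norm \<Omega> ?w = 1" unfolding scale[OF v] using pos by simp
    ultimately have "\<bar>F ?w\<bar> \<le> H1_dual_norm \<Omega> F"
      unfolding H1_dual_norm_def by (intro cSUP_upper H1_dual_bdd_above[OF F]) auto
    moreover have "\<forall>u\<in>H1 \<Omega>. \<forall>v\<in>H1 \<Omega>. \<forall>c d. F (\<lambda>x. c * u x + d * v x) = c * F u + d * F v"
      using F by (simp add: H1_dual_def)
    from this[rule_format, OF v v, of "1 / H1_norm \<Omega> v" 0] have "F ?w = (1 / H1_norm \<Omega> v) * F v"
      by simp
    ultimately have "\<bar>(1 / H1_norm \<Omega> v) * F v\<bar> \<le> H1_dual_norm \<Omega> F" by simp
    then show ?thesis using pos by (simp add: abs_mult field_simps)
  qed
qed

lemma function_seminorm_H1_dual: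
  assumes \<Omega>: "open \<Omega>" "bounded \<Omega>"
  shows "function_seminorm (H1_dual \<Omega>) (H1_dual_norm \<Omega>)"
proof
  let ?B = "{v \<in> H1 \<Omega>. H1_norm \<Omega> v \<le> 1}"
  have ne: "?B \<noteq> {}" using H1_zero H1_norm_zero[OF \<Omega>] by force
  fix F G c d assume F: "F \<in> H1_dual \<Omega>"
  show nn: "0 \<le> H1_dual_norm \<Omega> F"
  proof -
    obtain v where "v \<in> ?B" using ne by blast
    then show ?thesis
      unfolding H1_dual_norm_def by (intro cSUP_upper2[OF H1_dual_bdd_above[OF F]]) auto
  qed
  show "H1_dual_norm \<Omega> (\<lambda>x. c * F x) = \<bar>c\<bar> * H1_dual_norm \<Omega> F"
  proof (cases "c = 0")
    case True
    then show ?thesis using ne by (simp add: H1_dual_norm_def)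
  next
    case False
    have "(SUP v\<in>?B. \<bar>c\<bar> * \<bar>F v\<bar>) = \<bar>c\<bar> * (SUP v\<in>?B. \<bar>F v\<bar>)"
      using False continuous_at_Sup_mono[of "\<lambda>x. \<bar>c\<bar> * x" "(\<lambda>v. \<bar>F v\<bar>) ` ?B"] ne H1_dual_bdd_above[OF F]
      by (simp add: mono_def mult_left_mono image_comp comp_def continuous_intros)
    then show ?thesis by (simp add: H1_dual_norm_def abs_mult)
  qed
  assume G: "G \<in> H1_dual \<Omega>"
  from F G obtain C D where "\<forall>v\<in>H1 \<Omega>. \<bar>F v\<bar> \<le> C * H1_norm \<Omega> v" "\<forall>v\<in>H1 \<Omega>. \<bar>G v\<bar> \<le> D * H1_norm \<Omega> v"
    by (auto simp: H1_dual_def)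
  then have "\<bar>c * F v + d * G v\<bar> \<le> (\<bar>c\<bar> * C + \<bar>d\<bar> * D) * H1_norm \<Omega> v" if "v \<in> H1 \<Omega>" for v
  proof -
    have "\<bar>c * F v + d * G v\<bar> \<le> \<bar>c\<bar> * \<bar>F v\<bar> + \<bar>d\<bar> * \<bar>G v\<bar>"
      by (metis abs_mult abs_triangle_ineq)
    also have "\<dots> \<le> \<bar>c\<bar> * (C * H1_norm \<Omega> v) + \<bar>d\<bar> * (D * H1_norm \<Omega> v)"
      using that \<open>\<forall>v\<in>H1 \<Omega>. \<bar>F v\<bar> \<le> C * H1_norm \<Omega> v\<close> \<open>\<forall>v\<in>H1 \<Omega>. \<bar>G v\<bar> \<le> D * H1_norm \<Omega> v\<close>
      by (intro add_mono mult_left_mono) auto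
    finally show ?thesis by (simp add: algebra_simps)
  qed
  with F G show "(\<lambda>x. c * F x + d * G x) \<in> H1_dual \<Omega>"
    unfolding H1_dual_def by (auto simp: algebra_simps intro!: exI[of _ "\<bar>c\<bar> * C + \<bar>d\<bar> * D"])
  show "H1_dual_norm \<Omega> (\<lambda>x. F x + G x) \<le> H1_dual_norm \<Omega> F + H1_dual_norm \<Omega> G"
    unfolding H1_dual_norm_def[of _ "\<lambda>x. F x + G x"]
  proof (rule cSUP_least[OF ne])
    fix v assume v: "v \<in> ?B"
    have "\<bar>F v\<bar> \<le> H1_dual_norm \<Omega> F" "\<bar>G v\<bar> \<le> H1_dual_norm \<Omega> G"
      unfolding H1_dual_norm_def using v by (intro cSUP_upper H1_dual_bdd_above F G; simp)+
    then show "\<bar>F v + G v\<bar> \<le> H1_dual_norm \<Omega> F + H1_dual_norm \<Omega> G" by linarith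
  qed
qed

section \<open>Bochner spaces\<close>

text \<open>Completeness of Lebesgue measure: nothing is assumed about \<open>g\<close> off the set
  where it equals \<open>f\<close>. Extension by 0 reduces to the whole space.\<close>

lemma borel_measurable_lebesgue_on_AE:
  fixes f g :: "'a::euclidean_space \<Rightarrow> real"
  assumes S: "S \<in> sets lebesgue" and f: "f \<in> borel_measurable (lebesgue_on S)"
    and eq: "AE x in lebesgue_on S. f x = g x"
  shows "g \<in> borel_measurable (lebesgue_on S)"
proof -
  have "(\<lambda>x. indicator S x *\<^sub>R f x) \<in> borel_measurable lebesgue"
    using f S by (subst (asm) borel_measurable_restrict_space_iff) auto
  moreover have "AE x in lebesgue. indicator S x *\<^sub>R f x = indicator S x *\<^sub>R g x"
    using eq S by (subst (asm) AE_restrict_space_iff) (auto simp: indicator_def elim!: eventually_mono)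
  ultimately have "(\<lambda>x. indicator S x *\<^sub>R g x) \<in> borel_measurable lebesgue"
    by (rule borel_measurable_AE)
  then show ?thesis using S by (subst borel_measurable_restrict_space_iff) auto
qed

lemma borel_measurable_lebesgue_on_AE_LIMSEQ:
  fixes f :: "nat \<Rightarrow> 'a::euclidean_space \<Rightarrow> real"
  assumes S: "S \<in> sets lebesgue" and f: "\<And>k. f k \<in> borel_measurable (lebesgue_on S)"
    and lim: "AE x in lebesgue_on S. (\<lambda>k. f k x) \<longlonglongrightarrow> g x"
  shows "g \<in> borel_measurable (lebesgue_on S)"
proof (rule borel_measurable_lebesgue_on_AE[OF S])
  \<comment> \<open>\<open>lim\<close> gives a function that is measurable throughout; its
    unspecified values at points of divergence matter on a null set only.\<close>
  show "(\<lambda>x. lim (\<lambda>k. f k x)) \<in> borel_measurable (lebesgue_on S)"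
    using f by (rule borel_measurable_lim_metric)
  show "AE x in lebesgue_on S. lim (\<lambda>k. f k x) = g x"
    using lim by eventually_elim (rule limI)
qed

lemma strongly_measurableE:
  assumes "strongly_measurable T X N u"
  obtains s where "\<And>k. simple_function (lebesgue_on {0<..<T}) (s k)"
    "\<And>k t. t \<in> {0<..<T} \<Longrightarrow> s k t \<in> X"
    "AE t in lebesgue_on {0<..<T}. (\<lambda>k. N (\<lambda>x. s k t x - u t x)) \<longlonglongrightarrow> 0"
proof -
  from assms obtain s where
    "\<forall>k. simple_function (lebesgue_on {0<..<T}) (s k) \<and> (\<forall>t\<in>{0<..<T}. s k t \<in> X)"
    "AE t in lebesgue_on {0<..<T}. (\<lambda>k. N (\<lambda>x. s k t x - u t x)) \<longlonglongrightarrow> 0"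
    unfolding strongly_measurable_def by (elim exE conjE)
  then show thesis by (intro that[of s]) simp_all
qed

text \<open>The source of measurability in time. A simple function has finitely many values and
  measurable fibres, so its composition with any \<Phi> is again simple; the Lipschitz bound
  transports convergence in \<open>N\<close> to the reals.\<close>

lemma strongly_measurable_Lipschitz_borel:
  fixes \<Phi> :: "('s \<Rightarrow> real) \<Rightarrow> real"
  assumes u: "strongly_measurable T X N u" "AE t in lebesgue_on {0<..<T}. u t \<in> X"
    and \<Phi>: "\<And>x y. x \<in> X \<Longrightarrow> y \<in> X \<Longrightarrow> \<bar>\<Phi> x - \<Phi> y\<bar> \<le> C * N (\<lambda>a. x a - y a)"
  shows "(\<lambda>t. \<Phi> (u t)) \<in> borel_measurable (lebesgue_on {0<..<T})"
proof -
  obtain s where s: "\<And>k. simple_function (lebesgue_on {0<..<T}) (s k)"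
    "\<And>k t. t \<in> {0<..<T} \<Longrightarrow> s k t \<in> X"
    "AE t in lebesgue_on {0<..<T}. (\<lambda>k. N (\<lambda>x. s k t x - u t x)) \<longlonglongrightarrow> 0"
    using strongly_measurableE[OF u(1)] by blast
  show ?thesis
  proof (rule borel_measurable_lebesgue_on_AE_LIMSEQ)
    show "(\<lambda>t. \<Phi> (s k t)) \<in> borel_measurable (lebesgue_on {0<..<T})" for k
      using simple_function_compose1[OF s(1), of \<Phi> k] by (rule borel_measurable_simple_function)
    show "AE t in lebesgue_on {0<..<T}. (\<lambda>k. \<Phi> (s k t)) \<longlonglongrightarrow> \<Phi> (u t)"
      using s(3) u(2) AE_space[of "lebesgue_on {0<..<T}"]
    proof eventually_elim
      fix t assume t: "(\<lambda>k. N (\<lambda>x. s k t x - u t x)) \<longlonglongrightarrow> 0" "u t \<in> X"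
        "t \<in> space (lebesgue_on {0<..<T})"
      then have "\<bar>\<Phi> (s k t) - \<Phi> (u t)\<bar> \<le> C * N (\<lambda>x. s k t x - u t x)" for k
        using s(2) by (intro \<Phi>) simp_all
      moreover have "(\<lambda>k. C * N (\<lambda>x. s k t x - u t x)) \<longlonglongrightarrow> 0"
        using tendsto_mult_right_zero[OF t(1)] .
      ultimately have "(\<lambda>k. \<Phi> (s k t) - \<Phi> (u t)) \<longlonglongrightarrow> 0"
        by - (rule Lim_null_comparison[OF always_eventually], simp_all)
      then show "(\<lambda>k. \<Phi> (s k t)) \<longlonglongrightarrow> \<Phi> (u t)" by (rule LIM_zero_cancel)
    qed
  qed simp
qed

lemma L2_timeD:
  assumes "u \<in> L2_time T X N"
  shows "AE t in lebesgue_on {0<..<T}. u t \<in> X" "strongly_measurable T X N u"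
    "integrable (lebesgue_on {0<..<T}) (\<lambda>t. (N (u t))\<^sup>2)"
  using assms by (simp_all add: L2_time_def)

lemma L2_bound:
  assumes f: "f \<in> borel_measurable \<mu>" and g: "g \<in> L2 \<mu>" and le: "AE x in \<mu>. \<bar>f x\<bar> \<le> g x"
  shows "f \<in> L2 \<mu>"
proof -
  have "integrable \<mu> (\<lambda>x. (f x)\<^sup>2)"
  proof (rule Bochner_Integration.integrable_bound)
    show "integrable \<mu> (\<lambda>x. (g x)\<^sup>2)" using g by (simp add: L2_def)
    show "AE x in \<mu>. norm ((f x)\<^sup>2) \<le> norm ((g x)\<^sup>2)"
      using le
    proof eventually_elim
      fix x assume "\<bar>f x\<bar> \<le> g x"
      then have "\<bar>f x\<bar>\<^sup>2 \<le> (g x)\<^sup>2" by (intro power_mono) auto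
      then show "norm ((f x)\<^sup>2) \<le> norm ((g x)\<^sup>2)" by simp
    qed
  qed (use f in simp)
  with f show ?thesis by (simp add: L2_def)
qed

context function_seminorm
begin

lemma L2_time_norm_in_L2:
  assumes "u \<in> L2_time T X N"
  shows "(\<lambda>t. N (u t)) \<in> L2 (lebesgue_on {0<..<T})"
  using L2_timeD[OF assms] strongly_measurable_Lipschitz_borel[OF L2_timeD(2,1)[OF assms], of N 1] abs_norm_diff_le
  by (simp add: L2_def)

text \<open>Compatibility with differences turns the bound into a Lipschitz condition with the same
  constant. The instances are the inner product with a fixed function and the evaluation of a dual
  element at a fixed function.\<close>

lemma L2_time_functional:
  assumes u: "u \<in> L2_time T X N"
    and diff: "\<And>x y. x \<in> X \<Longrightarrow> y \<in> X \<Longrightarrow> \<Phi> (\<lambda>a. x a - y a) = \<Phi> x - \<Phi> y"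
    and bound: "\<And>x. x \<in> X \<Longrightarrow> \<bar>\<Phi> x\<bar> \<le> C * N x"
  shows "(\<lambda>t. \<Phi> (u t)) \<in> L2 (lebesgue_on {0<..<T})"
proof (rule L2_bound)
  show "(\<lambda>t. \<Phi> (u t)) \<in> borel_measurable (lebesgue_on {0<..<T})"
    using bound[OF diff_closed] by (intro strongly_measurable_Lipschitz_borel[OF L2_timeD(2,1)[OF u], where C=C])
      (simp add: diff)
  show "(\<lambda>t. C * N (u t)) \<in> L2 (lebesgue_on {0<..<T})"
    using L2_lincomb[OF L2_time_norm_in_L2[OF u] L2_time_norm_in_L2[OF u], of C 0] by simp
  show "AE t in lebesgue_on {0<..<T}. \<bar>\<Phi> (u t)\<bar> \<le> C * N (u t)"
    using L2_timeD(1)[OF u] by eventually_elim (rule bound)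
qed

lemma strongly_measurable_lincomb:
  assumes u: "strongly_measurable T X N u" "AE t in lebesgue_on {0<..<T}. u t \<in> X"
    and v: "strongly_measurable T X N v" "AE t in lebesgue_on {0<..<T}. v t \<in> X"
  shows "strongly_measurable T X N (\<lambda>t x. c * u t x + d * v t x)"
proof -
  obtain s where s: "\<And>k. simple_function (lebesgue_on {0<..<T}) (s k)"
    "\<And>k t. t \<in> {0<..<T} \<Longrightarrow> s k t \<in> X"
    "AE t in lebesgue_on {0<..<T}. (\<lambda>k. N (\<lambda>x. s k t x - u t x)) \<longlonglongrightarrow> 0"
    using strongly_measurableE[OF u(1)] by blast
  obtain r where r: "\<And>k. simple_function (lebesgue_on {0<..<T}) (r k)"
    "\<And>k t. t \<in> {0<..<T} \<Longrightarrow> r k t \<in> X"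
    "AE t in lebesgue_on {0<..<T}. (\<lambda>k. N (\<lambda>x. r k t x - v t x)) \<longlonglongrightarrow> 0"
    using strongly_measurableE[OF v(1)] by blast
  show ?thesis
    unfolding strongly_measurable_def
  proof (intro exI[of _ "\<lambda>k t x. c * s k t x + d * r k t x"] conjI allI ballI)
    show "simple_function (lebesgue_on {0<..<T}) (\<lambda>t x. c * s k t x + d * r k t x)" for k
      using simple_function_compose2[OF s(1) r(1), of "\<lambda>f g x. c * f x + d * g x"] .
    show "(\<lambda>x. c * s k t x + d * r k t x) \<in> X" if "t \<in> {0<..<T}" for k t
      using s(2) r(2) that by (intro lincomb)
    show "AE t in lebesgue_on {0<..<T}.
        (\<lambda>k. N (\<lambda>x. c * s k t x + d * r k t x - (c * u t x + d * v t x))) \<longlonglongrightarrow> 0"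
      using s(3) r(3) u(2) v(2) AE_space[of "lebesgue_on {0<..<T}"]
    proof eventually_elim
      fix t assume t: "(\<lambda>k. N (\<lambda>x. s k t x - u t x)) \<longlonglongrightarrow> 0" "(\<lambda>k. N (\<lambda>x. r k t x - v t x)) \<longlonglongrightarrow> 0"
        "u t \<in> X" "v t \<in> X" "t \<in> space (lebesgue_on {0<..<T})"
      have eq: "(\<lambda>x. c * s k t x + d * r k t x - (c * u t x + d * v t x))
          = (\<lambda>x. c * (s k t x - u t x) + d * (r k t x - v t x))" for k
        by (simp add: algebra_simps)
      have X: "(\<lambda>x. s k t x - u t x) \<in> X" "(\<lambda>x. r k t x - v t x) \<in> X" for k
        using t s(2) r(2) by (auto intro: diff_closed)
      have "norm (N (\<lambda>x. c * (s k t x - u t x) + d * (r k t x - v t x)))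
          \<le> \<bar>c\<bar> * N (\<lambda>x. s k t x - u t x) + \<bar>d\<bar> * N (\<lambda>x. r k t x - v t x)" for k
        using norm_lincomb_le[OF X] nonneg[OF lincomb[OF X]] by simp
      moreover have "(\<lambda>k. \<bar>c\<bar> * N (\<lambda>x. s k t x - u t x) + \<bar>d\<bar> * N (\<lambda>x. r k t x - v t x)) \<longlonglongrightarrow> 0"
        using t by (auto intro!: tendsto_eq_intros)
      ultimately show "(\<lambda>k. N (\<lambda>x. c * s k t x + d * r k t x - (c * u t x + d * v t x))) \<longlonglongrightarrow> 0"
        unfolding eq by - (rule Lim_null_comparison[OF always_eventually], simp_all)
    qed
  qed
qed

lemma L2_time_lincomb:
  assumes u: "u \<in> L2_time T X N" and v: "v \<in> L2_time T X N"
  shows "(\<lambda>t x. c * u t x + d * v t x) \<in> L2_time T X N"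
proof -
  let ?w = "\<lambda>t x. c * u t x + d * v t x"
  note u' = L2_timeD[OF u] and v' = L2_timeD[OF v]
  have X: "AE t in lebesgue_on {0<..<T}. ?w t \<in> X"
    using u'(1) v'(1) by eventually_elim (rule lincomb)
  have sm: "strongly_measurable T X N ?w"
    using u' v' by (intro strongly_measurable_lincomb)
  have "(\<lambda>t. N (?w t)) \<in> L2 (lebesgue_on {0<..<T})"
  proof (rule L2_bound)
    show "(\<lambda>t. N (?w t)) \<in> borel_measurable (lebesgue_on {0<..<T})"
      using abs_norm_diff_le by (intro strongly_measurable_Lipschitz_borel[OF sm X, where C=1]) simp
    show "(\<lambda>t. \<bar>c\<bar> * N (u t) + \<bar>d\<bar> * N (v t)) \<in> L2 (lebesgue_on {0<..<T})"
      using u v by (intro L2_lincomb L2_time_norm_in_L2)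
    show "AE t in lebesgue_on {0<..<T}. \<bar>N (?w t)\<bar> \<le> \<bar>c\<bar> * N (u t) + \<bar>d\<bar> * N (v t)"
      using u'(1) v'(1)
    proof eventually_elim
      fix t assume t: "u t \<in> X" "v t \<in> X"
      show "\<bar>N (?w t)\<bar> \<le> \<bar>c\<bar> * N (u t) + \<bar>d\<bar> * N (v t)"
        using norm_lincomb_le[OF t] nonneg[OF lincomb[OF t]] by simp
    qed
  qed
  with X sm show ?thesis by (simp add: L2_time_def L2_def)
qed

end

text \<open>States are controlled in the H^1 norm, but the cost measures them in L^2. The same
  simple functions serve for both, because the L^2 norm is the smaller one.\<close>

lemma L2_time_H1_imp_L2L2:
  assumes u: "u \<in> L2_time T (H1 \<Omega>) (H1_norm \<Omega>)"
  shows "u \<in> L2L2 T (lebesgue_on \<Omega>)"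
proof -
  note u' = L2_timeD[OF u]
  obtain s where s: "\<And>k. simple_function (lebesgue_on {0<..<T}) (s k)"
    "\<And>k t. t \<in> {0<..<T} \<Longrightarrow> s k t \<in> H1 \<Omega>"
    "AE t in lebesgue_on {0<..<T}. (\<lambda>k. H1_norm \<Omega> (\<lambda>x. s k t x - u t x)) \<longlonglongrightarrow> 0"
    using strongly_measurableE[OF u'(2)] by blast
  have "AE t in lebesgue_on {0<..<T}. (\<lambda>k. L2_norm (lebesgue_on \<Omega>) (\<lambda>x. s k t x - u t x)) \<longlonglongrightarrow> 0"
    using s(3)
    by eventually_elim
      (rule Lim_null_comparison[OF always_eventually], auto simp: L2_norm_le_H1_norm L2_norm_nonneg)
  with s have sm: "strongly_measurable T (L2 (lebesgue_on \<Omega>)) (L2_norm (lebesgue_on \<Omega>)) u"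
    unfolding strongly_measurable_def by (intro exI[of _ s]) (simp add: H1_subset_L2)
  have X: "AE t in lebesgue_on {0<..<T}. u t \<in> L2 (lebesgue_on \<Omega>)"
    using u'(1) by eventually_elim (rule H1_subset_L2)
  have "integrable (lebesgue_on {0<..<T}) (\<lambda>t. (L2_norm (lebesgue_on \<Omega>) (u t))\<^sup>2)"
  proof (rule Bochner_Integration.integrable_bound[OF u'(3)])
    show "(\<lambda>t. (L2_norm (lebesgue_on \<Omega>) (u t))\<^sup>2) \<in> borel_measurable (lebesgue_on {0<..<T})"
      using L2.abs_norm_diff_le
      by (intro borel_measurable_power strongly_measurable_Lipschitz_borel[OF sm X, where C=1]) simp
  qed (simp add: L2_norm_le_H1_norm L2_norm_nonneg power_mono)
  with sm X show ?thesis by (simp add: L2_time_def)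
qed

lemma L2_norm_cong_AE:
  assumes "f \<in> L2 \<mu>" "g \<in> L2 \<mu>" "AE x in \<mu>. f x = g x"
  shows "L2_norm \<mu> f = L2_norm \<mu> g"
proof -
  have "AE x in \<mu>. (f x)\<^sup>2 = (g x)\<^sup>2" using assms(3) by eventually_elim simp
  then have "(LINT x|\<mu>. (f x)\<^sup>2) = (LINT x|\<mu>. (g x)\<^sup>2)"
    using assms(1,2) by (intro integral_cong_AE) (auto simp: L2_def)
  then show ?thesis by (simp add: L2_norm_def)
qed

text \<open>This makes the cost independent of the representative chosen by
  \<open>state\<close>.\<close>

lemma L2L2_norm_cong:
  assumes u: "u \<in> L2L2 T \<mu>" and w: "w \<in> L2L2 T \<mu>" and eq: "eq_time T \<mu> u w"
  shows "L2L2_norm T \<mu> u = L2L2_norm T \<mu> w"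
  unfolding L2_time_norm_def
proof (intro arg_cong[where f=sqrt] integral_cong_AE)
  show "AE t in lebesgue_on {0<..<T}. (L2_norm \<mu> (u t))\<^sup>2 = (L2_norm \<mu> (w t))\<^sup>2"
    using L2_timeD(1)[OF u] L2_timeD(1)[OF w] eq[unfolded eq_time_def]
    by eventually_elim (use L2_norm_cong_AE in metis)
qed (use L2_timeD(3)[OF u] L2_timeD(3)[OF w] in \<open>auto intro: borel_measurable_integrable\<close>)

text \<open>The linear coefficient stays anonymous: for a unique minimiser only the sign of the
  leading coefficient matters.\<close>

lemma L2L2_norm_quadratic:
  assumes u: "u \<in> L2L2 T \<mu>" and v: "v \<in> L2L2 T \<mu>"
  obtains B where "\<And>l. (L2L2_norm T \<mu> (\<lambda>t x. u t x + l * v t x))\<^sup>2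
    = (L2L2_norm T \<mu> u)\<^sup>2 + l * B + l\<^sup>2 * (L2L2_norm T \<mu> v)\<^sup>2"
proof -
  let ?\<tau> = "lebesgue_on {0<..<T}"
  let ?N = "\<lambda>f. (L2_norm \<mu> f)\<^sup>2"
  have sq: "(L2L2_norm T \<mu> w)\<^sup>2 = (LINT t|?\<tau>. ?N (w t))" for w
    by (simp add: L2_time_norm_def integral_nonneg)
  have uv: "(\<lambda>t x. u t x + l * v t x) \<in> L2L2 T \<mu>" for l
    using L2.L2_time_lincomb[OF u v, of 1 l] by simp
  \<comment> \<open>Polarisation: \<open>?B t\<close> is twice the inner product of
    \<open>u t\<close> and \<open>v t\<close>. In this form it is integrable at once, being a
    combination of squared norms of three members of \<open>L2L2\<close>.\<close>
  let ?B = "\<lambda>t. ?N (\<lambda>x. u t x + v t x) - ?N (u t) - ?N (v t)"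
  note int = L2_timeD(3)[OF u] L2_timeD(3)[OF v] L2_timeD(3)[OF uv[of 1], simplified]
  have "(LINT t|?\<tau>. ?N (\<lambda>x. u t x + l * v t x)) = (LINT t|?\<tau>. ?N (u t) + l * ?B t + l\<^sup>2 * ?N (v t))" for l
  proof (rule integral_cong_AE)
    show "AE t in ?\<tau>. ?N (\<lambda>x. u t x + l * v t x) = ?N (u t) + l * ?B t + l\<^sup>2 * ?N (v t)"
      using L2_timeD(1)[OF u] L2_timeD(1)[OF v]
    proof eventually_elim
      fix t assume t: "u t \<in> L2 \<mu>" "v t \<in> L2 \<mu>"
      show "?N (\<lambda>x. u t x + l * v t x) = ?N (u t) + l * ?B t + l\<^sup>2 * ?N (v t)"
        using L2.lincomb_self[OF t, of 1 l] L2.lincomb_self[OF t, of 1 1]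
        by (simp add: L2_norm_power2 algebra_simps)
    qed
    show "(\<lambda>t. ?N (\<lambda>x. u t x + l * v t x)) \<in> borel_measurable ?\<tau>"
      using L2_timeD(3)[OF uv] by (rule borel_measurable_integrable)
    show "(\<lambda>t. ?N (u t) + l * ?B t + l\<^sup>2 * ?N (v t)) \<in> borel_measurable ?\<tau>"
      using int by (intro borel_measurable_integrable) simp
  qed
  also have "\<dots> l = (LINT t|?\<tau>. ?N (u t)) + l * (LINT t|?\<tau>. ?B t) + l\<^sup>2 * (LINT t|?\<tau>. ?N (v t))" for l
    using int by simp
  finally show thesis by (intro that) (simp only: sq)
qed

lemma L2L2_norm_eq_0D:
  assumes u: "u \<in> L2L2 T \<mu>" and zero: "L2L2_norm T \<mu> u = 0"
  shows "eq_time T \<mu> u (\<lambda>t x. 0)"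
proof -
  have "(LINT t|lebesgue_on {0<..<T}. (L2_norm \<mu> (u t))\<^sup>2) = 0"
    using zero by (simp add: L2_time_norm_def)
  then have "AE t in lebesgue_on {0<..<T}. (L2_norm \<mu> (u t))\<^sup>2 = 0"
    using L2_timeD(3)[OF u] by (subst (asm) integral_nonneg_eq_0_iff_AE) auto
  then show ?thesis
    unfolding eq_time_def using L2_timeD(1)[OF u]
  proof eventually_elim
    fix t assume t: "(L2_norm \<mu> (u t))\<^sup>2 = 0" "u t \<in> L2 \<mu>"
    then have "(LINT x|\<mu>. (u t x)\<^sup>2) = 0" by (simp add: L2_norm_def)
    then have "AE x in \<mu>. (u t x)\<^sup>2 = 0"
      using t(2) by (subst (asm) integral_nonneg_eq_0_iff_AE) (auto simp: L2_def)
    then show "AE x in \<mu>. u t x = 0" by simp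
  qed
qed

section \<open>Parts of the boundary, test functions in time, equality of time-dependent
  functions\<close>

text \<open>The trace operator is specified on the whole frontier, while the state equation
  integrates over its two parts separately.\<close>

lemma L2_restrict_space_subset:
  assumes A: "A \<in> sets M" and B: "B \<in> sets M" "B \<subseteq> A" and f: "f \<in> L2 (restrict_space M A)"
  shows "f \<in> L2 (restrict_space M B)"
proof -
  have B': "B \<in> sets (restrict_space M A)"
    using A B by (simp add: sets_restrict_space_iff)
  have eq: "restrict_space (restrict_space M A) B = restrict_space M B"
    using A B by (simp add: restrict_restrict_space Int_absorb1)
  have "integrable (restrict_space M A) (\<lambda>x. (f x)\<^sup>2)" "f \<in> borel_measurable (restrict_space M A)"
    using f by (simp_all add: L2_def)
  then have "integrable (restrict_space (restrict_space M A) B) (\<lambda>x. (f x)\<^sup>2)"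
    "f \<in> borel_measurable (restrict_space (restrict_space M A) B)"
    using B' integrable_mult_indicator[OF B', of "\<lambda>x. (f x)\<^sup>2"]
    by (simp_all add: integrable_restrict_space measurable_restrict_space1)
  then show ?thesis unfolding eq by (simp add: L2_def)
qed

lemma AE_restrict_space_subset:
  assumes A: "A \<in> sets M" and B: "B \<in> sets M" "B \<subseteq> A" and P: "AE x in restrict_space M A. P x"
  shows "AE x in restrict_space M B. P x"
proof -
  have "AE x in M. x \<in> A \<longrightarrow> P x"
    using P A by (subst (asm) AE_restrict_space_iff) auto
  then have "AE x in M. x \<in> B \<longrightarrow> P x"
    by eventually_elim (use B in blast)
  then show ?thesis using B by (subst AE_restrict_space_iff) auto
qed

text \<open>\<open>weak_time_derivative\<close> is phrased with \<open>deriv\<close>, which on the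
  real line is the Frechet derivative in the only basis direction, 1.\<close>

lemma test_function_deriv_L2:
  fixes \<phi> :: "real \<Rightarrow> real"
  assumes \<phi>: "test_function U \<phi>" and S: "S \<in> sets lebesgue"
  shows "deriv \<phi> \<in> L2 (lebesgue_on S)"
proof -
  obtain F where F: "\<And>x. (\<phi> has_derivative (\<lambda>h. F x \<bullet> h)) (at x)"
    using test_function_derivative[OF \<phi>] by metis
  have "deriv \<phi> x = frechet_derivative \<phi> (at x) 1" for x
  proof -
    have "(\<phi> has_field_derivative F x) (at x)"
      using F[of x] unfolding has_field_derivative_def inner_real_def .
    then have "deriv \<phi> x = F x" by (rule DERIV_imp_deriv)
    moreover have "F x \<bullet> 1 = frechet_derivative \<phi> (at x) 1"
      by (rule fun_cong[OF frechet_derivative_at[OF F[of x]]])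
    ultimately show ?thesis by simp
  qed
  then have "deriv \<phi> = (\<lambda>x. frechet_derivative \<phi> (at x) 1)" by (rule ext)
  moreover have "(\<lambda>x. frechet_derivative \<phi> (at x) 1) \<in> L2 (lebesgue_on S)"
    by (rule test_function_frechet_derivative_L2[OF \<phi> _ S]) simp
  ultimately show ?thesis by (simp only:)
qed

lemma eq_time_sym: "eq_time T \<mu> u w \<Longrightarrow> eq_time T \<mu> w u"
  by (simp add: eq_time_def eq_commute[of "u _ _"])

lemma eq_time_trans:
  assumes "eq_time T \<mu> u v" "eq_time T \<mu> v w"
  shows "eq_time T \<mu> u w"
  using assms unfolding eq_time_def
proof eventually_elim
  fix t assume "AE x in \<mu>. u t x = v t x" "AE x in \<mu>. v t x = w t x"
  then show "AE x in \<mu>. u t x = w t x" by eventually_elim simp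
qed

lemma eq_time_compose2:
  assumes "eq_time T \<mu> u u'" "eq_time T \<mu> w w'"
  shows "eq_time T \<mu> (\<lambda>t x. h (u t x) (w t x)) (\<lambda>t x. h (u' t x) (w' t x))"
  using assms unfolding eq_time_def
proof eventually_elim
  fix t assume "AE x in \<mu>. u t x = u' t x" "AE x in \<mu>. w t x = w' t x"
  then show "AE x in \<mu>. h (u t x) (w t x) = h (u' t x) (w' t x)" by eventually_elim simp
qed

section \<open>Affine dependence of the state on the control\<close>

locale heat_setting =
  fixes \<Omega> \<Gamma>1 \<Gamma>2 :: "'a::euclidean_space set" and tr :: "('a \<Rightarrow> real) \<Rightarrow> 'a \<Rightarrow> real"
  assumes \<Omega>: "open \<Omega>" "bounded \<Omega>"
    and frontier: "frontier \<Omega> = \<Gamma>1 \<union> \<Gamma>2"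
    and \<Gamma>: "\<Gamma>1 \<in> sets surface_measure" "\<Gamma>2 \<in> sets surface_measure"
    and trace: "trace_operator \<Omega> tr"
begin

sublocale H1: semi_inner_product "H1 \<Omega>" "H1_inner \<Omega>"
  rewrites "(\<lambda>u. sqrt (H1_inner \<Omega> u u)) = H1_norm \<Omega>" and "\<And>u. sqrt (H1_inner \<Omega> u u) = H1_norm \<Omega> u"
  using semi_inner_product_H1[OF \<Omega>] by (auto simp: H1_norm_altdef)

sublocale H1_dual: function_seminorm "H1_dual \<Omega>" "H1_dual_norm \<Omega>"
  using \<Omega> by (rule function_seminorm_H1_dual)

lemma trace_L2:
  assumes "v \<in> H1 \<Omega>"
  shows "tr v \<in> L2 (surface_on \<Gamma>1)" "tr v \<in> L2 (surface_on \<Gamma>2)"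
  using trace assms \<Gamma> L2_restrict_space_subset[of "\<Gamma>1 \<union> \<Gamma>2" surface_measure, where f="tr v"]
  by (auto simp: trace_operator_def frontier)

lemma trace_lincomb:
  assumes "u \<in> H1 \<Omega>" "v \<in> H1 \<Omega>"
  shows "AE x in surface_on \<Gamma>1. tr (\<lambda>y. c * u y + d * v y) x = c * tr u x + d * tr v x"
proof (rule AE_restrict_space_subset[of "\<Gamma>1 \<union> \<Gamma>2"])
  show "AE x in surface_on (\<Gamma>1 \<union> \<Gamma>2). tr (\<lambda>y. c * u y + d * v y) x = c * tr u x + d * tr v x"
    using trace assms unfolding trace_operator_def frontier by blast
qed (use \<Gamma> in auto)

lemma form_a_lincomb:
  assumes uv: "u \<in> H1 \<Omega>" "v \<in> H1 \<Omega>" and w: "w \<in> H1 \<Omega>"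
  shows "form_a \<Omega> \<Gamma>1 tr \<alpha> (\<lambda>x. c * u x + d * v x) w =
    c * form_a \<Omega> \<Gamma>1 tr \<alpha> u w + d * form_a \<Omega> \<Gamma>1 tr \<alpha> v w"
proof -
  let ?\<mu> = "surface_on \<Gamma>1" and ?z = "\<lambda>x. c * u x + d * v x"
  note int = L2_mult_integrable[OF trace_L2(1)[OF uv(1)] trace_L2(1)[OF w]]
    L2_mult_integrable[OF trace_L2(1)[OF uv(2)] trace_L2(1)[OF w]]
  have "(LINT x|?\<mu>. tr ?z x * tr w x) = (LINT x|?\<mu>. c * (tr u x * tr w x) + d * (tr v x * tr w x))"
  proof (rule integral_cong_AE)
    show "(\<lambda>x. tr ?z x * tr w x) \<in> borel_measurable ?\<mu>"
      using L2_mult_integrable[OF trace_L2(1)[OF H1.closed[OF uv]] trace_L2(1)[OF w]]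
      by (rule borel_measurable_integrable)
    show "(\<lambda>x. c * (tr u x * tr w x) + d * (tr v x * tr w x)) \<in> borel_measurable ?\<mu>"
      using int by (intro borel_measurable_integrable) simp
    show "AE x in ?\<mu>. tr ?z x * tr w x = c * (tr u x * tr w x) + d * (tr v x * tr w x)"
      using trace_lincomb[OF uv, of c d] by eventually_elim (simp add: algebra_simps)
  qed
  then show ?thesis
    using int dirichlet_form_lincomb[OF \<Omega> uv w]
    by (simp add: form_a_def dirichlet_form_def[symmetric] algebra_simps)
qed

text \<open>The continuous representatives combine to a continuous representative, whose value at
  time 0 is c + d times \<open>z\<close>; hence the condition on the weights.\<close>

lemma initial_value_affine:
  assumes u: "initial_value \<Omega> T u z" and u': "initial_value \<Omega> T u' z" and cd: "c + d = 1"
  shows "initial_value \<Omega> T (\<lambda>t x. c * u t x + d * u' t x) z"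
proof -
  let ?\<mu> = "lebesgue_on \<Omega>"
  from u obtain U where U: "eq_time T ?\<mu> U u" "\<forall>t\<in>{0..T}. U t \<in> L2 ?\<mu>"
    "\<forall>s\<in>{0..T}. ((\<lambda>t. L2_norm ?\<mu> (\<lambda>x. U t x - U s x)) \<longlongrightarrow> 0) (at s within {0..T})"
    "AE x in ?\<mu>. U 0 x = z x"
    unfolding initial_value_def by blast
  from u' obtain U' where U': "eq_time T ?\<mu> U' u'" "\<forall>t\<in>{0..T}. U' t \<in> L2 ?\<mu>"
    "\<forall>s\<in>{0..T}. ((\<lambda>t. L2_norm ?\<mu> (\<lambda>x. U' t x - U' s x)) \<longlongrightarrow> 0) (at s within {0..T})"
    "AE x in ?\<mu>. U' 0 x = z x"
    unfolding initial_value_def by blast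
  let ?W = "\<lambda>t x. c * U t x + d * U' t x"
  have "eq_time T ?\<mu> ?W (\<lambda>t x. c * u t x + d * u' t x)"
    using U(1) U'(1) by (rule eq_time_compose2)
  moreover have "((\<lambda>t. L2_norm ?\<mu> (\<lambda>x. ?W t x - ?W s x)) \<longlongrightarrow> 0) (at s within {0..T})"
    if s: "s \<in> {0..T}" for s
  proof (rule Lim_null_comparison)
    show "((\<lambda>t. \<bar>c\<bar> * L2_norm ?\<mu> (\<lambda>x. U t x - U s x) + \<bar>d\<bar> * L2_norm ?\<mu> (\<lambda>x. U' t x - U' s x)) \<longlongrightarrow> 0)
        (at s within {0..T})"
      using U(3) U'(3) s by (auto intro!: tendsto_eq_intros)
    have "norm (L2_norm ?\<mu> (\<lambda>x. ?W t x - ?W s x))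
        \<le> \<bar>c\<bar> * L2_norm ?\<mu> (\<lambda>x. U t x - U s x) + \<bar>d\<bar> * L2_norm ?\<mu> (\<lambda>x. U' t x - U' s x)"
      if t: "t \<in> {0..T}" for t
    proof -
      have eq: "(\<lambda>x. ?W t x - ?W s x) = (\<lambda>x. c * (U t x - U s x) + d * (U' t x - U' s x))"
        by (simp add: algebra_simps)
      show ?thesis
        using s t U(2) U'(2) unfolding eq
        by (simp add: L2_norm_nonneg L2.norm_lincomb_le L2.diff_closed)
    qed
    then show "\<forall>\<^sub>F t in at s within {0..T}. norm (L2_norm ?\<mu> (\<lambda>x. ?W t x - ?W s x))
        \<le> \<bar>c\<bar> * L2_norm ?\<mu> (\<lambda>x. U t x - U s x) + \<bar>d\<bar> * L2_norm ?\<mu> (\<lambda>x. U' t x - U' s x)"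
      by (auto simp: eventually_at_filter)
  qed
  moreover have "AE x in ?\<mu>. ?W 0 x = z x"
    using U(4) U'(4) by eventually_elim (simp add: cd flip: distrib_right)
  ultimately show ?thesis
    unfolding initial_value_def using U(2) U'(2) by (intro exI[of _ ?W]) (auto intro: L2_lincomb)
qed

text \<open>Pairing with \<open>v\<close> is bounded in the L^2 norm by Cauchy-Schwarz, hence also
  in the H^1 norm, the one in which \<open>u\<close> is strongly measurable.\<close>

lemma inner_time_L2:
  assumes u: "u \<in> L2_time T (H1 \<Omega>) (H1_norm \<Omega>)" and v: "v \<in> H1 \<Omega>"
  shows "(\<lambda>t. L2_inner (lebesgue_on \<Omega>) (u t) v) \<in> L2 (lebesgue_on {0<..<T})"
proof (rule H1.L2_time_functional[OF u])
  fix x y assume xy: "x \<in> H1 \<Omega>" "y \<in> H1 \<Omega>"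
  show "L2_inner (lebesgue_on \<Omega>) (\<lambda>a. x a - y a) v = L2_inner (lebesgue_on \<Omega>) x v - L2_inner (lebesgue_on \<Omega>) y v"
    using L2.linear_left[OF xy[THEN H1_subset_L2] H1_subset_L2[OF v], of 1 "-1"] by simp
  have "\<bar>L2_inner (lebesgue_on \<Omega>) x v\<bar> \<le> L2_norm (lebesgue_on \<Omega>) x * L2_norm (lebesgue_on \<Omega>) v"
    using L2.Cauchy_Schwarz[OF xy(1)[THEN H1_subset_L2] H1_subset_L2[OF v]] .
  also have "\<dots> \<le> L2_norm (lebesgue_on \<Omega>) v * H1_norm \<Omega> x"
    by (subst mult.commute) (intro mult_left_mono L2_norm_le_H1_norm L2_norm_nonneg)
  finally show "\<bar>L2_inner (lebesgue_on \<Omega>) x v\<bar> \<le> L2_norm (lebesgue_on \<Omega>) v * H1_norm \<Omega> x" .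
qed

text \<open>Evaluation at a fixed \<open>v\<close> is a bounded linear functional on the dual, with
  constant \<open>H1_norm \<Omega> v\<close>.\<close>

lemma dual_time_L2:
  assumes w: "w \<in> L2_time T (H1_dual \<Omega>) (H1_dual_norm \<Omega>)" and v: "v \<in> H1 \<Omega>"
  shows "(\<lambda>t. w t v) \<in> L2 (lebesgue_on {0<..<T})"
proof (rule H1_dual.L2_time_functional[OF w])
  fix F assume "F \<in> H1_dual \<Omega>"
  from H1_dual_le[OF \<Omega> this v] show "\<bar>F v\<bar> \<le> H1_norm \<Omega> v * H1_dual_norm \<Omega> F"
    by (simp add: mult.commute)
qed simp

text \<open>Every integrand is a product of two square integrable functions of time, one of them
  \<phi> or its derivative; this is what permits splitting the integrals.\<close>

lemma weak_time_derivative_lincomb: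
  assumes u: "u \<in> L2_time T (H1 \<Omega>) (H1_norm \<Omega>)" "u' \<in> L2_time T (H1 \<Omega>) (H1_norm \<Omega>)"
    and w: "w \<in> L2_time T (H1_dual \<Omega>) (H1_dual_norm \<Omega>)" "w' \<in> L2_time T (H1_dual \<Omega>) (H1_dual_norm \<Omega>)"
    and d: "weak_time_derivative \<Omega> T u w" "weak_time_derivative \<Omega> T u' w'"
  shows "weak_time_derivative \<Omega> T (\<lambda>t x. c * u t x + d * u' t x) (\<lambda>t v. c * w t v + d * w' t v)"
  unfolding weak_time_derivative_def
proof (intro ballI allI impI)
  let ?\<tau> = "lebesgue_on {0<..<T}" and ?I = "L2_inner (lebesgue_on \<Omega>)"
  fix v \<phi> assume v: "v \<in> H1 \<Omega>" and \<phi>: "test_function {0<..<T} \<phi>"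
  have \<phi>_L2: "\<phi> \<in> L2 ?\<tau>" and \<phi>'_L2: "deriv \<phi> \<in> L2 ?\<tau>"
    using \<phi> by (auto intro: test_function_imp_L2 test_function_deriv_L2)
  note int_u = u[THEN inner_time_L2, OF v, THEN L2_mult_integrable, OF \<phi>'_L2]
  note int_w = w[THEN dual_time_L2, OF v, THEN L2_mult_integrable, OF \<phi>_L2]
  have "(LINT t|?\<tau>. ?I (\<lambda>x. c * u t x + d * u' t x) v * deriv \<phi> t) =
      (LINT t|?\<tau>. c * (?I (u t) v * deriv \<phi> t) + d * (?I (u' t) v * deriv \<phi> t))"
  proof (rule integral_cong_AE)
    show "(\<lambda>t. ?I (\<lambda>x. c * u t x + d * u' t x) v * deriv \<phi> t) \<in> borel_measurable ?\<tau>"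
      using L2_mult_integrable[OF inner_time_L2[OF H1.L2_time_lincomb[OF u] v] \<phi>'_L2]
      by (rule borel_measurable_integrable)
    show "(\<lambda>t. c * (?I (u t) v * deriv \<phi> t) + d * (?I (u' t) v * deriv \<phi> t)) \<in> borel_measurable ?\<tau>"
      using int_u by (intro borel_measurable_integrable) simp
    show "AE t in ?\<tau>. ?I (\<lambda>x. c * u t x + d * u' t x) v * deriv \<phi> t =
        c * (?I (u t) v * deriv \<phi> t) + d * (?I (u' t) v * deriv \<phi> t)"
      using L2_timeD(1)[OF u(1)] L2_timeD(1)[OF u(2)]
      by eventually_elim (simp add: L2.linear_left H1_subset_L2 v algebra_simps)
  qed
  also have "\<dots> = - (c * (LINT t|?\<tau>. w t v * \<phi> t) + d * (LINT t|?\<tau>. w' t v * \<phi> t))"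
    using int_u d v \<phi> by (simp add: weak_time_derivative_def)
  also have "\<dots> = - (LINT t|?\<tau>. (c * w t v + d * w' t v) * \<phi> t)"
    using int_w by (simp add: distrib_right mult.assoc)
  finally show "(LINT t|?\<tau>. ?I (\<lambda>x. c * u t x + d * u' t x) v * deriv \<phi> t) =
      - (LINT t|?\<tau>. (c * w t v + d * w' t v) * \<phi> t)" .
qed

text \<open>State, time derivative and control enter the equation linearly, whereas the terms with
  \<open>g\<close> and \<open>b\<close> and the initial value are reproduced with the factor c + d =
  1.\<close>

lemma is_state_affine:
  assumes u: "is_state \<Omega> \<Gamma>1 \<Gamma>2 tr T g b vb \<alpha> q u" and u': "is_state \<Omega> \<Gamma>1 \<Gamma>2 tr T g b vb \<alpha> q' u'"
    and q: "q \<in> L2L2 T (surface_on \<Gamma>2)" "q' \<in> L2L2 T (surface_on \<Gamma>2)" and cd: "c + d = 1"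
  shows "is_state \<Omega> \<Gamma>1 \<Gamma>2 tr T g b vb \<alpha> (\<lambda>t x. c * q t x + d * q' t x) (\<lambda>t x. c * u t x + d * u' t x)"
proof -
  let ?\<tau> = "lebesgue_on {0<..<T}"
  let ?R = "\<lambda>t q v. L2_inner (lebesgue_on \<Omega>) (g t) v - L2_inner (surface_on \<Gamma>2) q (tr v)
             + \<alpha> * (LINT x|surface_on \<Gamma>1. b x * tr v x)"
  from u obtain w where uL: "u \<in> L2_time T (H1 \<Omega>) (H1_norm \<Omega>)" and ui: "initial_value \<Omega> T u vb"
    and w: "w \<in> L2_time T (H1_dual \<Omega>) (H1_dual_norm \<Omega>)" "weak_time_derivative \<Omega> T u w"
      "AE t in ?\<tau>. \<forall>v\<in>H1 \<Omega>. w t v + form_a \<Omega> \<Gamma>1 tr \<alpha> (u t) v = ?R t (q t) v"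
    unfolding is_state_def by blast
  from u' obtain w' where u'L: "u' \<in> L2_time T (H1 \<Omega>) (H1_norm \<Omega>)" and u'i: "initial_value \<Omega> T u' vb"
    and w': "w' \<in> L2_time T (H1_dual \<Omega>) (H1_dual_norm \<Omega>)" "weak_time_derivative \<Omega> T u' w'"
      "AE t in ?\<tau>. \<forall>v\<in>H1 \<Omega>. w' t v + form_a \<Omega> \<Gamma>1 tr \<alpha> (u' t) v = ?R t (q' t) v"
    unfolding is_state_def by blast
  have "AE t in ?\<tau>. \<forall>v\<in>H1 \<Omega>. (c * w t v + d * w' t v) + form_a \<Omega> \<Gamma>1 tr \<alpha> (\<lambda>x. c * u t x + d * u' t x) v
      = ?R t (\<lambda>x. c * q t x + d * q' t x) v"
    using w(3) w'(3) L2_timeD(1)[OF uL] L2_timeD(1)[OF u'L] L2_timeD(1)[OF q(1)] L2_timeD(1)[OF q(2)]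
  proof eventually_elim
    fix t
    assume t: "\<forall>v\<in>H1 \<Omega>. w t v + form_a \<Omega> \<Gamma>1 tr \<alpha> (u t) v = ?R t (q t) v"
      "\<forall>v\<in>H1 \<Omega>. w' t v + form_a \<Omega> \<Gamma>1 tr \<alpha> (u' t) v = ?R t (q' t) v"
      "u t \<in> H1 \<Omega>" "u' t \<in> H1 \<Omega>" "q t \<in> L2 (surface_on \<Gamma>2)" "q' t \<in> L2 (surface_on \<Gamma>2)"
    show "\<forall>v\<in>H1 \<Omega>. (c * w t v + d * w' t v) + form_a \<Omega> \<Gamma>1 tr \<alpha> (\<lambda>x. c * u t x + d * u' t x) v
      = ?R t (\<lambda>x. c * q t x + d * q' t x) v"
    proof
      fix v assume v: "v \<in> H1 \<Omega>"
      have "(c * w t v + d * w' t v) + form_a \<Omega> \<Gamma>1 tr \<alpha> (\<lambda>x. c * u t x + d * u' t x) v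
          = c * (w t v + form_a \<Omega> \<Gamma>1 tr \<alpha> (u t) v) + d * (w' t v + form_a \<Omega> \<Gamma>1 tr \<alpha> (u' t) v)"
        using t v by (simp add: form_a_lincomb algebra_simps)
      also have "\<dots> = c * ?R t (q t) v + d * ?R t (q' t) v" using t(1,2) v by simp
      also have "\<dots> = (c + d) * (L2_inner (lebesgue_on \<Omega>) (g t) v + \<alpha> * (LINT x|surface_on \<Gamma>1. b x * tr v x))
          - (c * L2_inner (surface_on \<Gamma>2) (q t) (tr v) + d * L2_inner (surface_on \<Gamma>2) (q' t) (tr v))"
        by (simp only: ring_distribs)
      also have "\<dots> = ?R t (\<lambda>x. c * q t x + d * q' t x) v"
        using t(5,6) trace_L2(2)[OF v] by (simp add: cd L2.linear_left)
      finally show "(c * w t v + d * w' t v) + form_a \<Omega> \<Gamma>1 tr \<alpha> (\<lambda>x. c * u t x + d * u' t x) v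
          = ?R t (\<lambda>x. c * q t x + d * q' t x) v" .
    qed
  qed
  moreover have "(\<lambda>t v. c * w t v + d * w' t v) \<in> L2_time T (H1_dual \<Omega>) (H1_dual_norm \<Omega>)"
    using w(1) w'(1) by (rule H1_dual.L2_time_lincomb)
  moreover have "weak_time_derivative \<Omega> T (\<lambda>t x. c * u t x + d * u' t x) (\<lambda>t v. c * w t v + d * w' t v)"
    using uL u'L w(1) w'(1) w(2) w'(2) by (rule weak_time_derivative_lincomb)
  moreover have "(\<lambda>t x. c * u t x + d * u' t x) \<in> L2_time T (H1 \<Omega>) (H1_norm \<Omega>)"
    using uL u'L by (rule H1.L2_time_lincomb)
  moreover have "initial_value \<Omega> T (\<lambda>t x. c * u t x + d * u' t x) vb"
    using ui u'i cd by (rule initial_value_affine)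
  ultimately show ?thesis
    unfolding is_state_def by (intro conjI bexI)
qed

end

section \<open>Minimisation of the quadratic cost\<close>

text \<open>Completing the square settles existence and uniqueness together, with the vertex as
  witness.\<close>

lemma quadratic_unique_minimizer:
  fixes A B C :: real
  assumes A: "A > 0"
  shows "\<exists>!l. \<forall>m. A * l\<^sup>2 + B * l + C \<le> A * m\<^sup>2 + B * m + C"
proof (rule ex1I)
  have square: "A * m\<^sup>2 + B * m + C = A * (m + B / (2 * A))\<^sup>2 + (C - B\<^sup>2 / (4 * A))" for m
    using A by (simp add: power2_eq_square field_simps)
  show "\<forall>m. A * (- (B / (2 * A)))\<^sup>2 + B * (- (B / (2 * A))) + C \<le> A * m\<^sup>2 + B * m + C"
    unfolding square using A by simp
  fix l assume "\<forall>m. A * l\<^sup>2 + B * l + C \<le> A * m\<^sup>2 + B * m + C"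
  from this[rule_format, of "- (B / (2 * A))"] have "A * (l + B / (2 * A))\<^sup>2 \<le> 0"
    unfolding square by simp
  then have "(l + B / (2 * A))\<^sup>2 \<le> 0" using A by (simp add: mult_le_0_iff)
  then show "l = - (B / (2 * A))" by simp
qed

theorem theorem5p5:
  fixes \<Omega> \<Gamma>1 \<Gamma>2 :: "(real ^ 'n) set"
    and tr :: "(real ^ 'n \<Rightarrow> real) \<Rightarrow> real ^ 'n \<Rightarrow> real"
    and g zd q0 :: "real \<Rightarrow> real ^ 'n \<Rightarrow> real"
    and b vb :: "real ^ 'n \<Rightarrow> real"
    and M T \<alpha> :: real
  assumes domain: "open \<Omega>" "connected \<Omega>" "\<Omega> \<noteq> {}" "bounded \<Omega>" "lipschitz_boundary \<Omega>"
    and boundary: "frontier \<Omega> = \<Gamma>1 \<union> \<Gamma>2" "\<Gamma>1 \<inter> \<Gamma>2 = {}"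
      "\<Gamma>1 \<in> sets surface_measure" "\<Gamma>2 \<in> sets surface_measure"
      "emeasure surface_measure \<Gamma>1 > 0" "emeasure surface_measure \<Gamma>2 > 0"
    and trace: "trace_operator \<Omega> tr"
    and T: "T > 0"
    and \<alpha>: "\<alpha> > 0"
    and M: "M > 0"
    and g: "g \<in> L2L2 T (lebesgue_on \<Omega>)"
    and zd: "zd \<in> L2L2 T (lebesgue_on \<Omega>)"
    and b: "b \<in> H_half \<Gamma>1"
    and vb: "vb \<in> H1 \<Omega>" "AE x in surface_on \<Gamma>1. tr vb x = b x"
    and well_posed: "\<forall>q \<in> L2L2 T (surface_on \<Gamma>2). uniquely_solvable \<Omega> \<Gamma>1 \<Gamma>2 tr T g b vb \<alpha> q"
    and q0: "q0 \<in> L2L2 T (surface_on \<Gamma>2)" "\<not> eq_time T (surface_on \<Gamma>2) q0 (\<lambda>t x. 0)"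
  shows "let H = (\<lambda>l. cost_J \<Omega> \<Gamma>1 \<Gamma>2 tr T g b vb zd M \<alpha> (\<lambda>t x. l * q0 t x))
         in \<exists>!l::real. \<forall>m. H l \<le> H m"
proof -
  interpret heat_setting \<Omega> \<Gamma>1 \<Gamma>2 tr
    using domain boundary trace by unfold_locales auto
  let ?\<mu> = "lebesgue_on \<Omega>" and ?S = "\<lambda>l. state \<Omega> \<Gamma>1 \<Gamma>2 tr T g b vb \<alpha> (\<lambda>t x. l * q0 t x)"
  let ?is = "\<lambda>l. is_state \<Omega> \<Gamma>1 \<Gamma>2 tr T g b vb \<alpha> (\<lambda>t x. l * q0 t x)"
  have q: "(\<lambda>t x. l * q0 t x) \<in> L2L2 T (surface_on \<Gamma>2)" for l
    using L2.L2_time_lincomb[OF q0(1) q0(1), of l 0] by simp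
  have uniq: "\<exists>u. ?is l u \<and> (\<forall>u'. ?is l u' \<longrightarrow> eq_time T ?\<mu> u' u)" for l
    using bspec[OF well_posed q[of l]] unfolding uniquely_solvable_def .
  have state: "?is l (?S l)" for l
  proof -
    have "\<exists>u. ?is l u" using uniq[of l] by blast
    then show ?thesis unfolding state_def by (rule someI_ex)
  qed
  \<comment> \<open>The controls 0 and \<open>q0\<close> are treated as the multiples of
    \<open>q0\<close> by 0 and 1, so both states belong to the family \<open>?S\<close>.\<close>
  define u0 where "u0 = ?S 0"
  define u1 where "u1 = ?S 1"
  let ?a = "\<lambda>t x. u0 t x - zd t x" and ?d = "\<lambda>t x. u1 t x - u0 t x"
  have L2: "u \<in> L2L2 T ?\<mu>" if "?is l u" for l u
    using that unfolding is_state_def by (intro L2_time_H1_imp_L2L2) (rule conjunct1)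
  have is01: "?is 0 u0" "?is 1 u1"
    unfolding u0_def u1_def by (rule state)+
  note L = L2[OF is01(1)] L2[OF is01(2)] L2[OF state]
  have diff: "(\<lambda>t x. u t x - v t x) \<in> L2L2 T ?\<mu>" if "u \<in> L2L2 T ?\<mu>" "v \<in> L2L2 T ?\<mu>" for u v
    using L2.L2_time_lincomb[OF that, of 1 "-1"] by simp
  have cost: "L2L2_norm T ?\<mu> (\<lambda>t x. ?S l t x - zd t x) = L2L2_norm T ?\<mu> (\<lambda>t x. ?a t x + l * ?d t x)" for l
  proof (rule L2L2_norm_cong)
    show "(\<lambda>t x. ?S l t x - zd t x) \<in> L2L2 T ?\<mu>" using L(3) zd by (rule diff)
    show "(\<lambda>t x. ?a t x + l * ?d t x) \<in> L2L2 T ?\<mu>"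
      using L2.L2_time_lincomb[OF diff[OF L(1) zd] diff[OF L(2,1)], of 1 l] by simp
    \<comment> \<open>The control belonging to this combination is (1 - l) times 0 plus l times
      \<open>q0\<close>, so it solves the same problem as \<open>?S l\<close> and unique solvability
      identifies the two.\<close>
    have "?is l (\<lambda>t x. (1 - l) * u0 t x + l * u1 t x)"
      using is_state_affine[OF is01 q q, of "1 - l" l] by simp
    then have "eq_time T ?\<mu> (?S l) (\<lambda>t x. (1 - l) * u0 t x + l * u1 t x)"
      using uniq[of l] state[of l] by (meson eq_time_sym eq_time_trans)
    moreover have "eq_time T ?\<mu> zd zd" by (simp add: eq_time_def)
    ultimately have "eq_time T ?\<mu> (\<lambda>t x. ?S l t x - zd t x)
        (\<lambda>t x. (1 - l) * u0 t x + l * u1 t x - zd t x)"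
      by (rule eq_time_compose2)
    also have "(\<lambda>t x. (1 - l) * u0 t x + l * u1 t x - zd t x) = (\<lambda>t x. ?a t x + l * ?d t x)"
      by (simp add: algebra_simps)
    finally show "eq_time T ?\<mu> (\<lambda>t x. ?S l t x - zd t x) (\<lambda>t x. ?a t x + l * ?d t x)" .
  qed
  obtain B where B: "\<And>l. (L2L2_norm T ?\<mu> (\<lambda>t x. ?a t x + l * ?d t x))\<^sup>2
      = (L2L2_norm T ?\<mu> ?a)\<^sup>2 + l * B + l\<^sup>2 * (L2L2_norm T ?\<mu> ?d)\<^sup>2"
    using L2L2_norm_quadratic[OF diff[OF L(1) zd] diff[OF L(2,1)]] by blast
  let ?n = "L2L2_norm T (surface_on \<Gamma>2) q0"
  have nq: "(L2L2_norm T (surface_on \<Gamma>2) (\<lambda>t x. l * q0 t x))\<^sup>2 = l\<^sup>2 * ?n\<^sup>2" for l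
  proof -
    \<comment> \<open>No integrability is required here: pulling out a constant is valid even where
      the integral is 0 by convention.\<close>
    have "(L2_norm (surface_on \<Gamma>2) (\<lambda>x. l * q0 t x))\<^sup>2 = l\<^sup>2 * (L2_norm (surface_on \<Gamma>2) (q0 t))\<^sup>2" for t
      by (simp add: L2_norm_def power_mult_distrib integral_nonneg)
    then show ?thesis by (simp add: L2_time_norm_def integral_nonneg)
  qed
  have "?n \<noteq> 0" using L2L2_norm_eq_0D[OF q0(1)] q0(2) by blast
  \<comment> \<open>The states may coincide, which makes the first summand 0; strictness comes from
    the control term alone.\<close>
  then have pos: "1 / 2 * (L2L2_norm T ?\<mu> ?d)\<^sup>2 + M / 2 * ?n\<^sup>2 > 0"
    using M by (simp add: add_nonneg_pos)
  have H: "cost_J \<Omega> \<Gamma>1 \<Gamma>2 tr T g b vb zd M \<alpha> (\<lambda>t x. l * q0 t x)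
      = (1 / 2 * (L2L2_norm T ?\<mu> ?d)\<^sup>2 + M / 2 * ?n\<^sup>2) * l\<^sup>2 + (1 / 2 * B) * l + 1 / 2 * (L2L2_norm T ?\<mu> ?a)\<^sup>2" for l
    unfolding cost_J_def cost B nq by (simp add: algebra_simps)
  show ?thesis
    unfolding Let_def H by (rule quadratic_unique_minimizer[OF pos])
qed

end
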